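(* Let $G$ be a (Gromov) hyperbolic group that is the fundamental group of a compact special cube complex. Then the Gromov boundary $\partial G$ is a quotient of a compact subset of $\mathbb{R}^3$ with connected preimages; that is, there exist a compact subset $\Lambda\subseteq\mathbb{R}^3$ and a quotient map $q:\Lambda\to\partial G$ (a continuous surjection for which $\partial G$ carries the quotient topology) such that $q^{-1}(p)$ is connected for every $p\in\partial G$.
   Context: "Special cube complex" is meant in the standard sense of Haglund and Wise: a non-positively curved cube complex whose immersed hyperplanes are two-sided, embedded, do not directly self-osculate, and such that no two hyperplanes inter-osculate. The Gromov boundary $\partial G$ has its usual topology. *)

theory Defs
  imports "HOL-Analysis.Analysis" "HOL-Algebra.Generated_Groups"
begin

section \<open>Quotient topologies and fundamental groups\<close>

definition quotient_top :: "'a topology \<Rightarrow> ('a \<times> 'a) set \<Rightarrow> 'a set topology" where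
  "quotient_top X R = topology (\<lambda>\<U>. \<U> \<subseteq> topspace X // R \<and> openin X (\<Union>\<U>))"

lemma openin_quotient_top:
  assumes "equiv (topspace X) R"
  shows "openin (quotient_top X R) \<U> \<longleftrightarrow> \<U> \<subseteq> topspace X // R \<and> openin X (\<Union>\<U>)"
proof -
  have "istopology (\<lambda>\<U>. \<U> \<subseteq> topspace X // R \<and> openin X (\<Union>\<U>))"
    unfolding istopology_def
  proof (intro conjI allI impI)
    fix S T
    assume S: "S \<subseteq> topspace X // R \<and> openin X (\<Union>S)"
      and T: "T \<subseteq> topspace X // R \<and> openin X (\<Union>T)"
    show "S \<inter> T \<subseteq> topspace X // R" using S by blast
    have "\<Union>(S \<inter> T) = \<Union>S \<inter> \<Union>T"
    proof
      show "\<Union>S \<inter> \<Union>T \<subseteq> \<Union>(S \<inter> T)"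
      proof
        fix x assume "x \<in> \<Union>S \<inter> \<Union>T"
        then obtain A B where AB: "A \<in> S" "x \<in> A" "B \<in> T" "x \<in> B" by blast
        then have "A = B" using quotient_disj[OF assms, of A B] S T by blast
        then show "x \<in> \<Union>(S \<inter> T)" using AB by blast
      qed
    qed blast
    then show "openin X (\<Union>(S \<inter> T))" using S T by auto
  next
    fix \<K>
    assume K: "\<forall>S\<in>\<K>. S \<subseteq> topspace X // R \<and> openin X (\<Union>S)"
    then show "\<Union>\<K> \<subseteq> topspace X // R" by blast
    have "\<Union>(\<Union>\<K>) = \<Union>(Union ` \<K>)" by blast
    then show "openin X (\<Union>(\<Union>\<K>))" using K by auto
  qed
  then show ?thesis unfolding quotient_top_def by simp
qed

lemma topspace_quotient_top:
  assumes "equiv (topspace X) R"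
  shows "topspace (quotient_top X R) = topspace X // R"
proof -
  have "openin (quotient_top X R) (topspace X // R)"
    using assms by (simp add: openin_quotient_top Union_quotient)
  then show ?thesis
    using openin_quotient_top[OF assms] by (metis openin_subset openin_topspace subset_antisym)
qed

definition loops_at :: "'a topology \<Rightarrow> 'a \<Rightarrow> (real \<Rightarrow> 'a) set" where
  "loops_at X x = {p. pathin X p \<and> p 0 = x \<and> p 1 = x}"

definition loop_homotopy :: "'a topology \<Rightarrow> 'a \<Rightarrow> ((real \<Rightarrow> 'a) \<times> (real \<Rightarrow> 'a)) set" where
  "loop_homotopy X x = {(p, q). p \<in> loops_at X x \<and> q \<in> loops_at X x \<and>
     homotopic_with (\<lambda>r. r 0 = x \<and> r 1 = x) (top_of_set {0..1}) X p q}"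

text \<open>The library's join of paths is restricted to topological type classes.\<close>

definition loop_join :: "(real \<Rightarrow> 'a) \<Rightarrow> (real \<Rightarrow> 'a) \<Rightarrow> real \<Rightarrow> 'a" where
  "loop_join p q = (\<lambda>t. if t \<le> 1/2 then p (2 * t) else q (2 * t - 1))"

definition fundamental_group :: "'a topology \<Rightarrow> 'a \<Rightarrow> (real \<Rightarrow> 'a) set monoid" where
  "fundamental_group X x =
     \<lparr>carrier = loops_at X x // loop_homotopy X x,
      mult = (\<lambda>A B. loop_homotopy X x `` {loop_join p q | p q. p \<in> A \<and> q \<in> B}),
      one = loop_homotopy X x `` {\<lambda>_. x}\<rparr>"


section \<open>Cube complexes\<close>

text \<open>Points of the \<open>n\<close>-cube are extensional functions on \<open>{..<n}\<close> with values in \<open>[0,1]\<close>.\<close>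

definition std_cube :: "nat \<Rightarrow> (nat \<Rightarrow> real) topology" where
  "std_cube n = product_topology (\<lambda>_. top_of_set {0..1}) {..<n}"

definition cube_dist :: "nat \<Rightarrow> (nat \<Rightarrow> real) \<Rightarrow> (nat \<Rightarrow> real) \<Rightarrow> real" where
  "cube_dist n x y = L2_set (\<lambda>i. x i - y i) {..<n}"

text \<open>The smallest closed face containing \<open>x\<close>, and the relative interior of that face.\<close>

definition supp_face :: "nat \<Rightarrow> (nat \<Rightarrow> real) \<Rightarrow> (nat \<Rightarrow> real) set" where
  "supp_face n x =
     {y \<in> topspace (std_cube n). \<forall>i<n. (x i = 0 \<longrightarrow> y i = 0) \<and> (x i = 1 \<longrightarrow> y i = 1)}"

definition supp_face_interior :: "nat \<Rightarrow> (nat \<Rightarrow> real) \<Rightarrow> (nat \<Rightarrow> real) set" where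
  "supp_face_interior n x =
     {y \<in> topspace (std_cube n). \<forall>i<n. (x i = 0 \<longleftrightarrow> y i = 0) \<and> (x i = 1 \<longleftrightarrow> y i = 1)}"

definition face_isometry ::
    "nat \<Rightarrow> (nat \<Rightarrow> real) set \<Rightarrow> nat \<Rightarrow> (nat \<Rightarrow> real) set \<Rightarrow> ((nat \<Rightarrow> real) \<Rightarrow> nat \<Rightarrow> real) \<Rightarrow> bool" where
  "face_isometry m F n F' h \<longleftrightarrow>
     bij_betw h F F' \<and> (\<forall>x\<in>F. \<forall>y\<in>F. cube_dist n (h x) (h y) = cube_dist m x y)"

record 'c cube_gluing =
  cubes :: "'c set"
  cdim :: "'c \<Rightarrow> nat"
  glue :: "(('c \<times> (nat \<Rightarrow> real)) \<times> ('c \<times> (nat \<Rightarrow> real))) set"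

definition cube_union :: "'c cube_gluing \<Rightarrow> ('c \<times> (nat \<Rightarrow> real)) topology" where
  "cube_union K = sum_topology (\<lambda>c. std_cube (cdim K c)) (cubes K)"

text \<open>
  A cube complex is a polyhedral complex in the sense of Bridson and Haefliger all of whose cells are
  unit cubes: cubes are glued along faces by isometries, each open face embeds, but a cube need not
  embed (so that, for example, a torus obtained from one square and a circle obtained from one edge
  are allowed).
\<close>

definition cube_complex :: "'c cube_gluing \<Rightarrow> bool" where
  "cube_complex K \<longleftrightarrow>
     equiv (topspace (cube_union K)) (glue K) \<and>
     (\<forall>c x y. ((c, x), (c, y)) \<in> glue K \<and> y \<in> supp_face_interior (cdim K c) x \<longrightarrow> x = y) \<and>
     (\<forall>c x d y. ((c, x), (d, y)) \<in> glue K \<longrightarrow>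
        (\<exists>h. face_isometry (cdim K c) (supp_face (cdim K c) x) (cdim K d) (supp_face (cdim K d) y) h \<and>
             h x = y \<and>
             (\<forall>z\<in>supp_face (cdim K c) x. ((c, z), (d, h z)) \<in> glue K)))"

definition realization :: "'c cube_gluing \<Rightarrow> ('c \<times> (nat \<Rightarrow> real)) set topology" where
  "realization K = quotient_top (cube_union K) (glue K)"

definition cell_pt :: "'c cube_gluing \<Rightarrow> 'c \<Rightarrow> (nat \<Rightarrow> real) \<Rightarrow> ('c \<times> (nat \<Rightarrow> real)) set" where
  "cell_pt K c x = glue K `` {(c, x)}"


section \<open>Corners, directed edges and links\<close>

definition cube_vertices :: "nat \<Rightarrow> (nat \<Rightarrow> real) set" where
  "cube_vertices n = (\<Pi>\<^sub>E i\<in>{..<n}. {0, 1})"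

text \<open>
  The triple \<open>(c, v, I)\<close>, with \<open>v\<close> a vertex of the cube \<open>c\<close> and \<open>I\<close> a set of coordinate directions,
  is the corner at \<open>v\<close> of the face of \<open>c\<close> through \<open>v\<close> in the directions \<open>I\<close>;
  \<open>corner_chart v I\<close> parametrizes that face, with the parameter \<open>0\<close> corresponding to \<open>v\<close>.
\<close>

definition corners :: "'c cube_gluing \<Rightarrow> ('c \<times> (nat \<Rightarrow> real) \<times> nat set) set" where
  "corners K =
     {(c, v, I). c \<in> cubes K \<and> v \<in> cube_vertices (cdim K c) \<and> I \<subseteq> {..<cdim K c}}"

definition corner_chart :: "(nat \<Rightarrow> real) \<Rightarrow> nat set \<Rightarrow> (nat \<Rightarrow> real) \<Rightarrow> nat \<Rightarrow> real" where
  "corner_chart v I s = (\<lambda>i. if i \<in> I then (if v i = 0 then s i else 1 - s i) else v i)"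

text \<open>Two corners are the same if their faces are identified in the complex, compatibly with the
  corner points.\<close>

definition same_corner ::
    "'c cube_gluing \<Rightarrow> ('c \<times> (nat \<Rightarrow> real) \<times> nat set) \<Rightarrow> ('c \<times> (nat \<Rightarrow> real) \<times> nat set) \<Rightarrow> bool" where
  "same_corner K = (\<lambda>(c, v, I) (d, w, J).
     \<exists>\<sigma>. bij_betw \<sigma> I J \<and>
         (\<forall>s\<in>J \<rightarrow> {0..1}. cell_pt K c (corner_chart v I (s \<circ> \<sigma>)) = cell_pt K d (corner_chart w J s)))"

text \<open>
  A directed edge is represented by its parametrization \<open>[0,1] \<rightarrow> K\<close>. Its origin is its value at \<open>0\<close>.
  Directed edges with origin \<open>x\<close> are the vertices of the link of \<open>x\<close>; in particular a loop
  contributes two of them.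
\<close>

definition dedge :: "'c cube_gluing \<Rightarrow> 'c \<Rightarrow> (nat \<Rightarrow> real) \<Rightarrow> nat \<Rightarrow> real \<Rightarrow> ('c \<times> (nat \<Rightarrow> real)) set" where
  "dedge K c v i = (\<lambda>t\<in>{0..1}. cell_pt K c (corner_chart v {i} (\<lambda>_. t)))"

definition dedges :: "'c cube_gluing \<Rightarrow> (real \<Rightarrow> ('c \<times> (nat \<Rightarrow> real)) set) set" where
  "dedges K = {dedge K c v i | c v i. c \<in> cubes K \<and> v \<in> cube_vertices (cdim K c) \<and> i < cdim K c}"

definition rev_edge :: "(real \<Rightarrow> 'a) \<Rightarrow> real \<Rightarrow> 'a" where
  "rev_edge e = (\<lambda>t\<in>{0..1}. e (1 - t))"

text \<open>The simplex of the link determined by a corner, given by its set of vertices.\<close>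

definition corner_simplex ::
    "'c cube_gluing \<Rightarrow> ('c \<times> (nat \<Rightarrow> real) \<times> nat set) \<Rightarrow> (real \<Rightarrow> ('c \<times> (nat \<Rightarrow> real)) set) set" where
  "corner_simplex K = (\<lambda>(c, v, I). dedge K c v ` I)"

text \<open>The link of every vertex is a simplicial complex: a simplex has as many vertices as its
  dimension requires, and it is determined by its vertices.\<close>

definition simplicial_links :: "'c cube_gluing \<Rightarrow> bool" where
  "simplicial_links K \<longleftrightarrow>
     (\<forall>(c, v, I)\<in>corners K. inj_on (dedge K c v) I) \<and>
     (\<forall>A\<in>corners K. \<forall>B\<in>corners K.
        corner_simplex K A \<noteq> {} \<and> corner_simplex K A = corner_simplex K B \<longrightarrow> same_corner K A B)"

text \<open>Two directed edges with a common origin form the corner of a square, that is, they are adjacent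
  in the link.\<close>

definition link_adjacent ::
    "'c cube_gluing \<Rightarrow> (real \<Rightarrow> ('c \<times> (nat \<Rightarrow> real)) set) \<Rightarrow> (real \<Rightarrow> ('c \<times> (nat \<Rightarrow> real)) set) \<Rightarrow> bool" where
  "link_adjacent K e f \<longleftrightarrow>
     (\<exists>c v i j. c \<in> cubes K \<and> v \<in> cube_vertices (cdim K c) \<and> i < cdim K c \<and> j < cdim K c \<and> i \<noteq> j \<and>
        e = dedge K c v i \<and> f = dedge K c v j)"

definition flag_links :: "'c cube_gluing \<Rightarrow> bool" where
  "flag_links K \<longleftrightarrow>
     (\<forall>E. finite E \<and> E \<noteq> {} \<and> E \<subseteq> dedges K \<and> (\<forall>e\<in>E. \<forall>f\<in>E. e \<noteq> f \<longrightarrow> link_adjacent K e f) \<longrightarrow>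
        (\<exists>A\<in>corners K. corner_simplex K A = E))"

definition nonpositively_curved :: "'c cube_gluing \<Rightarrow> bool" where
  "nonpositively_curved K \<longleftrightarrow> cube_complex K \<and> simplicial_links K \<and> flag_links K"


section \<open>Hyperplanes and special cube complexes\<close>

text \<open>Opposite edges of a square, directed the same way.\<close>

definition elementary_parallel ::
    "'c cube_gluing \<Rightarrow> (real \<Rightarrow> ('c \<times> (nat \<Rightarrow> real)) set) \<Rightarrow> (real \<Rightarrow> ('c \<times> (nat \<Rightarrow> real)) set) \<Rightarrow> bool" where
  "elementary_parallel K e f \<longleftrightarrow>
     (\<exists>c v i j. c \<in> cubes K \<and> v \<in> cube_vertices (cdim K c) \<and> i < cdim K c \<and> j < cdim K c \<and> i \<noteq> j \<and>
        e = dedge K c v i \<and> f = dedge K c (v(j := 1 - v j)) i)"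

definition parallel ::
    "'c cube_gluing \<Rightarrow> (real \<Rightarrow> ('c \<times> (nat \<Rightarrow> real)) set) \<Rightarrow> (real \<Rightarrow> ('c \<times> (nat \<Rightarrow> real)) set) \<Rightarrow> bool" where
  "parallel K = equivclp (elementary_parallel K)"

text \<open>
  Following Haglund and Wise, an immersed hyperplane is represented by the parallelism class of
  (undirected) edges dual to it, here given as a set of directed edges closed under reversal.
\<close>

definition hyperplane_of ::
    "'c cube_gluing \<Rightarrow> (real \<Rightarrow> ('c \<times> (nat \<Rightarrow> real)) set) \<Rightarrow> (real \<Rightarrow> ('c \<times> (nat \<Rightarrow> real)) set) set" where
  "hyperplane_of K e = {f \<in> dedges K. parallel K e f \<or> parallel K e (rev_edge f)}"

definition hyperplanes :: "'c cube_gluing \<Rightarrow> (real \<Rightarrow> ('c \<times> (nat \<Rightarrow> real)) set) set set" where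
  "hyperplanes K = hyperplane_of K ` dedges K"

text \<open>For \<open>H = H'\<close> this says that \<open>H\<close> crosses itself, i.e. that \<open>H\<close> is not embedded.\<close>

definition crosses ::
    "'c cube_gluing \<Rightarrow> (real \<Rightarrow> ('c \<times> (nat \<Rightarrow> real)) set) set \<Rightarrow> (real \<Rightarrow> ('c \<times> (nat \<Rightarrow> real)) set) set \<Rightarrow> bool" where
  "crosses K H H' \<longleftrightarrow> (\<exists>e\<in>H. \<exists>f\<in>H'. link_adjacent K e f)"

definition two_sided :: "'c cube_gluing \<Rightarrow> (real \<Rightarrow> ('c \<times> (nat \<Rightarrow> real)) set) set \<Rightarrow> bool" where
  "two_sided K H \<longleftrightarrow> (\<forall>e\<in>H. \<not> parallel K e (rev_edge e))"

definition embedded :: "'c cube_gluing \<Rightarrow> (real \<Rightarrow> ('c \<times> (nat \<Rightarrow> real)) set) set \<Rightarrow> bool" where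
  "embedded K H \<longleftrightarrow> \<not> crosses K H H"

text \<open>Self-osculation at a common terminus is covered by reversing both edges.\<close>

definition directly_self_osculates :: "'c cube_gluing \<Rightarrow> (real \<Rightarrow> ('c \<times> (nat \<Rightarrow> real)) set) set \<Rightarrow> bool" where
  "directly_self_osculates K H \<longleftrightarrow>
     (\<exists>e\<in>H. \<exists>f\<in>H. e \<noteq> f \<and> parallel K e f \<and> e 0 = f 0 \<and> \<not> link_adjacent K e f)"

definition osculate ::
    "'c cube_gluing \<Rightarrow> (real \<Rightarrow> ('c \<times> (nat \<Rightarrow> real)) set) set \<Rightarrow> (real \<Rightarrow> ('c \<times> (nat \<Rightarrow> real)) set) set \<Rightarrow> bool" where
  "osculate K H H' \<longleftrightarrow> (\<exists>e\<in>H. \<exists>f\<in>H'. e \<noteq> f \<and> e 0 = f 0 \<and> \<not> link_adjacent K e f)"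

definition inter_osculate ::
    "'c cube_gluing \<Rightarrow> (real \<Rightarrow> ('c \<times> (nat \<Rightarrow> real)) set) set \<Rightarrow> (real \<Rightarrow> ('c \<times> (nat \<Rightarrow> real)) set) set \<Rightarrow> bool" where
  "inter_osculate K H H' \<longleftrightarrow> crosses K H H' \<and> osculate K H H'"

definition special_cube_complex :: "'c cube_gluing \<Rightarrow> bool" where
  "special_cube_complex K \<longleftrightarrow>
     nonpositively_curved K \<and>
     (\<forall>H\<in>hyperplanes K. two_sided K H \<and> embedded K H \<and> \<not> directly_self_osculates K H) \<and>
     (\<forall>H\<in>hyperplanes K. \<forall>H'\<in>hyperplanes K. H \<noteq> H' \<longrightarrow> \<not> inter_osculate K H H')"


section \<open>Gromov hyperbolicity and the Gromov boundary\<close>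

definition gromov_product :: "('a \<Rightarrow> 'a \<Rightarrow> real) \<Rightarrow> 'a \<Rightarrow> 'a \<Rightarrow> 'a \<Rightarrow> real" where
  "gromov_product d w x y = (d x w + d y w - d x y) / 2"

definition gromov_hyperbolic :: "'a set \<Rightarrow> ('a \<Rightarrow> 'a \<Rightarrow> real) \<Rightarrow> bool" where
  "gromov_hyperbolic X d \<longleftrightarrow>
     (\<exists>\<delta>. \<forall>x\<in>X. \<forall>y\<in>X. \<forall>z\<in>X. \<forall>w\<in>X.
        gromov_product d w x z \<ge> min (gromov_product d w x y) (gromov_product d w y z) - \<delta>)"

definition sequences_to_infinity :: "'a set \<Rightarrow> ('a \<Rightarrow> 'a \<Rightarrow> real) \<Rightarrow> 'a \<Rightarrow> (nat \<Rightarrow> 'a) set" where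
  "sequences_to_infinity X d w =
     {u. range u \<subseteq> X \<and>
         filterlim (\<lambda>(i, j). gromov_product d w (u i) (u j)) at_top (sequentially \<times>\<^sub>F sequentially)}"

definition boundary_equiv :: "'a set \<Rightarrow> ('a \<Rightarrow> 'a \<Rightarrow> real) \<Rightarrow> 'a \<Rightarrow> ((nat \<Rightarrow> 'a) \<times> (nat \<Rightarrow> 'a)) set" where
  "boundary_equiv X d w =
     {(u, v). u \<in> sequences_to_infinity X d w \<and> v \<in> sequences_to_infinity X d w \<and>
        filterlim (\<lambda>(i, j). gromov_product d w (u i) (v j)) at_top (sequentially \<times>\<^sub>F sequentially)}"

definition boundary_points :: "'a set \<Rightarrow> ('a \<Rightarrow> 'a \<Rightarrow> real) \<Rightarrow> 'a \<Rightarrow> (nat \<Rightarrow> 'a) set set" where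
  "boundary_points X d w = sequences_to_infinity X d w // boundary_equiv X d w"

definition boundary_nhd ::
    "'a set \<Rightarrow> ('a \<Rightarrow> 'a \<Rightarrow> real) \<Rightarrow> 'a \<Rightarrow> (nat \<Rightarrow> 'a) set \<Rightarrow> real \<Rightarrow> (nat \<Rightarrow> 'a) set set" where
  "boundary_nhd X d w p r =
     {q \<in> boundary_points X d w. \<exists>u\<in>p. \<exists>v\<in>q.
        ereal r \<le> Liminf (sequentially \<times>\<^sub>F sequentially)
                    (\<lambda>(i, j). ereal (gromov_product d w (u i) (v j)))}"

text \<open>The usual topology: the sets \<open>boundary_nhd X d w p r\<close>, for real \<open>r\<close>, are a basis of (not
  necessarily open) neighbourhoods of \<open>p\<close>. It does not depend on the base point \<open>w\<close>.\<close>

definition boundary_top :: "'a set \<Rightarrow> ('a \<Rightarrow> 'a \<Rightarrow> real) \<Rightarrow> 'a \<Rightarrow> (nat \<Rightarrow> 'a) set topology" where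
  "boundary_top X d w = topology (\<lambda>U.
     U \<subseteq> boundary_points X d w \<and> (\<forall>p\<in>U. \<exists>r. boundary_nhd X d w p r \<subseteq> U))"

lemma boundary_nhd_antimono:
  "r \<le> s \<Longrightarrow> boundary_nhd X d w p s \<subseteq> boundary_nhd X d w p r"
  unfolding boundary_nhd_def using order_trans[of "ereal r" "ereal s"] by (simp add: subset_iff) blast

lemma openin_boundary_top:
  "openin (boundary_top X d w) U \<longleftrightarrow>
     U \<subseteq> boundary_points X d w \<and> (\<forall>p\<in>U. \<exists>r. boundary_nhd X d w p r \<subseteq> U)"
proof -
  have "istopology (\<lambda>U. U \<subseteq> boundary_points X d w \<and> (\<forall>p\<in>U. \<exists>r. boundary_nhd X d w p r \<subseteq> U))"
    unfolding istopology_def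
  proof (intro conjI allI impI ballI)
    fix S T p
    assume S: "S \<subseteq> boundary_points X d w \<and> (\<forall>p\<in>S. \<exists>r. boundary_nhd X d w p r \<subseteq> S)"
      and T: "T \<subseteq> boundary_points X d w \<and> (\<forall>p\<in>T. \<exists>r. boundary_nhd X d w p r \<subseteq> T)"
      and p: "p \<in> S \<inter> T"
    obtain r s where "boundary_nhd X d w p r \<subseteq> S" "boundary_nhd X d w p s \<subseteq> T"
      using S T p by blast
    then have "boundary_nhd X d w p (max r s) \<subseteq> S \<inter> T"
      using boundary_nhd_antimono[of r "max r s" X d w p] boundary_nhd_antimono[of s "max r s" X d w p]
      by auto
    then show "\<exists>r. boundary_nhd X d w p r \<subseteq> S \<inter> T" by blast
  next
    fix \<K> p
    assume K: "\<forall>S\<in>\<K>. S \<subseteq> boundary_points X d w \<and> (\<forall>p\<in>S. \<exists>r. boundary_nhd X d w p r \<subseteq> S)"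
      and "p \<in> \<Union>\<K>"
    then obtain S where "S \<in> \<K>" "p \<in> S" by blast
    with K obtain r where "boundary_nhd X d w p r \<subseteq> S" by blast
    with \<open>S \<in> \<K>\<close> show "\<exists>r. boundary_nhd X d w p r \<subseteq> \<Union>\<K>" by blast
  qed blast+
  then show ?thesis unfolding boundary_top_def by simp
qed

lemma topspace_boundary_top: "topspace (boundary_top X d w) = boundary_points X d w"
proof -
  have "openin (boundary_top X d w) (boundary_points X d w)"
    unfolding openin_boundary_top by (auto simp: boundary_nhd_def)
  then show ?thesis
    by (metis openin_boundary_top openin_subset openin_topspace subset_antisym)
qed


section \<open>Hyperbolic groups\<close>

definition word_norm :: "('g, 'm) monoid_scheme \<Rightarrow> 'g set \<Rightarrow> 'g \<Rightarrow> nat" where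
  "word_norm G S g =
     (LEAST n. \<exists>xs. length xs = n \<and> set xs \<subseteq> S \<union> m_inv G ` S \<and> foldr (mult G) xs (one G) = g)"

definition word_dist :: "('g, 'm) monoid_scheme \<Rightarrow> 'g set \<Rightarrow> 'g \<Rightarrow> 'g \<Rightarrow> real" where
  "word_dist G S g h = real (word_norm G S (mult G (m_inv G g) h))"

definition finite_generating_set :: "('g, 'm) monoid_scheme \<Rightarrow> 'g set \<Rightarrow> bool" where
  "finite_generating_set G S \<longleftrightarrow> finite S \<and> S \<subseteq> carrier G \<and> generate G S = carrier G"

definition hyperbolic_group :: "('g, 'm) monoid_scheme \<Rightarrow> bool" where
  "hyperbolic_group G \<longleftrightarrow>
     group G \<and>
     (\<exists>S. finite_generating_set G S \<and> gromov_hyperbolic (carrier G) (word_dist G S))"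

text \<open>Up to canonical homeomorphism this does not depend on \<open>S\<close>, for \<open>G\<close> hyperbolic.\<close>

definition gromov_boundary :: "('g, 'm) monoid_scheme \<Rightarrow> 'g set \<Rightarrow> (nat \<Rightarrow> 'g) set topology" where
  "gromov_boundary G S = boundary_top (carrier G) (word_dist G S) (one G)"

end

theory Submission
  imports Defs "HOL-Real_Asymp.Real_Asymp"
begin

text \<open>
  Let \<open>C\<close> be a compact subset of the line and \<open>f\<close> a continuous map from \<open>C\<close> onto a Hausdorff space
  \<open>X\<close>. Put one copy of \<open>C\<close> on each of two skew lines in \<open>\<real>\<^sup>3\<close>. The segments that join a point of the first
  line to a point of the second one are pairwise disjoint except for common end points. Let \<open>\<Lambda>\<close> be
  the union of the segments from \<open>a\<close> to \<open>b\<close> with \<open>f a = f b\<close>. Since \<open>X\<close> is Hausdorff, the pairs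
  \<open>(a, b)\<close> with this property form a closed set, so \<open>\<Lambda>\<close> is compact. The map that sends the whole
  segment from \<open>a\<close> to \<open>b\<close> to \<open>f a\<close> is a quotient map from \<open>\<Lambda>\<close> onto \<open>X\<close>, and its fibre over \<open>p\<close> is
  the join of \<open>f\<^sup>-\<^sup>1(p)\<close> with itself, which is connected. This is
  \<open>monotone_quotient_of_compact_subset_R3\<close>.

  It remains to see that the boundary of a hyperbolic group is a Hausdorff continuous image of a
  compact subset of the line. The geodesic rays from the identity in a Cayley graph form a compact
  totally disconnected space: a ray is a branch of a finitely branching tree, and it is coded by a
  sequence of natural numbers and then by a real number through its ternary digits. Sending a ray to
  its end point is continuous, because rays that agree for a long time have close end points, and
  it is onto by a compactness argument (\<open>continuous_endpoint\<close>, \<open>endpoint_surj\<close>).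

  All that this uses of hyperbolicity is a coarse ultrametric inequality for the Gromov product: if
  \<open>(x | y)\<close> and \<open>(y | z)\<close> are large then so is \<open>(x | z)\<close>. A hyperbolic group satisfies the four
  point condition for some finite generating set, but the boundary is formed with a given one. The
  two word metrics are bilipschitz equivalent, and the half of the Morse lemma saying that a
  geodesic of the hyperbolic metric stays close to every geodesic of the other metric with the same end points
  (\<open>geodesic_close_to_other_geodesic\<close>) suffices to compare the two Gromov products up to
  multiplicative and additive constants. The coarse ultrametric inequality survives such a
  comparison (\<open>coarsely_ultrametric_transfer\<close>).
\<close>

section \<open>Joins on two skew lines and monotone quotients\<close>

text \<open>The point at time \<open>t\<close> on the segment from \<open>(a, 0, 0)\<close> on the first axis to \<open>(0, b, 1)\<close> on a
  line skew to it. For \<open>0 < t < 1\<close> the point determines \<open>a\<close> and \<open>b\<close>.\<close>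
definition join_point :: "real \<Rightarrow> real \<Rightarrow> real \<Rightarrow> real ^ 3" where
  "join_point a b t = vector [(1 - t) * a, t * b, t]"

lemma join_point_nth [simp]:
  "join_point a b t $ 1 = (1 - t) * a" "join_point a b t $ 2 = t * b" "join_point a b t $ 3 = t"
  by (simp_all add: join_point_def)

lemma continuous_on_join_point [continuous_intros]:
  assumes "continuous_on A f" "continuous_on A g" "continuous_on A h"
  shows "continuous_on A (\<lambda>x. join_point (f x) (g x) (h x))"
proof -
  have "continuous_on A (\<lambda>x. join_point (f x) (g x) (h x) $ i)" for i
    using exhaust_3[of i] by (elim disjE; simp; intro continuous_intros assms)
  then have "continuous_on A (\<lambda>x. \<chi> i. join_point (f x) (g x) (h x) $ i)"
    by (rule continuous_on_vec_lambda)
  then show ?thesis by simp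
qed

text \<open>The segments from a fixed \<open>a\<close> share their origin, so they form a connected cone; all these cones
  contain the end point of the segments towards a fixed \<open>c\<close>.\<close>
lemma connected_join_of_sets:
  assumes "A \<noteq> {}"
  shows "connected {join_point a b t | a b t. a \<in> A \<and> b \<in> A \<and> t \<in> {0..1}}" (is "connected ?J")
proof -
  obtain c where "c \<in> A" using assms by blast
  define seg where "seg a b = join_point a b ` {0..1}" for a b
  have seg: "connected (seg a b)" for a b
    unfolding seg_def by (intro connected_continuous_image continuous_intros connected_Icc)
  have start: "join_point a 0 0 \<in> seg a b" for a b
    unfolding seg_def by (rule image_eqI[of _ _ 0]) (auto simp: join_point_def)
  have finish: "join_point 0 b 1 \<in> seg a b" for a b
    unfolding seg_def by (rule image_eqI[of _ _ 1]) (auto simp: join_point_def)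
  define cone where "cone a = (\<Union>b\<in>A. seg a b)" for a
  have cone: "connected (cone a)" for a
    unfolding cone_def
  proof (intro connected_Union)
    show "\<Inter> (seg a ` A) \<noteq> {}" using start by blast
  qed (use seg in auto)
  have "join_point 0 c 1 \<in> cone a" for a
    unfolding cone_def using finish \<open>c \<in> A\<close> by blast
  then have "connected (\<Union>a\<in>A. cone a)"
  proof (intro connected_Union)
    show "\<Inter> (cone ` A) \<noteq> {}" using \<open>\<And>a. join_point 0 c 1 \<in> cone a\<close> by blast
  qed (use cone in auto)
  also have "(\<Union>a\<in>A. cone a) = ?J"
    unfolding cone_def seg_def image_def by blast
  finally show ?thesis .
qed

text \<open>The join construction. Restricting the join of \<open>C\<close> with itself to pairs with the same image
  replaces each fibre \<open>F\<close> of \<open>f\<close> by the connected join of \<open>F\<close> with itself, in a continuous way.\<close>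
theorem monotone_quotient_of_compact_subset_R3:
  fixes C :: "real set" and f :: "real \<Rightarrow> 'a"
  assumes "compact C" and f: "continuous_map (top_of_set C) X f"
    and surj: "f ` C = topspace X" and X: "Hausdorff_space X"
  shows "\<exists>(\<Lambda> :: (real ^ 3) set) q. compact \<Lambda> \<and> quotient_map (top_of_set \<Lambda>) X q \<and>
    (\<forall>p\<in>topspace X. connected {y \<in> \<Lambda>. q y = p})"
proof -
  define D where "D = {z \<in> C \<times> C. f (fst z) = f (snd z)} \<times> {0..1::real}"
  define j where "j = (\<lambda>((a, b), t). join_point a b t)"
  define \<Lambda> where "\<Lambda> = j ` D"
  \<comment> \<open>Both ends of a segment have the same image, so either of them can be used away from the other:
    \<open>a\<close> is recovered from the first coordinate before time 1, and \<open>b\<close> is the second one at time 1.\<close>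
  define q where "q y = (if y $ 3 < 1 then f (y $ 1 / (1 - y $ 3)) else f (y $ 2))" for y :: "real ^ 3"
  have fst_snd: "continuous_map (top_of_set (C \<times> C)) X (f \<circ> fst)"
    "continuous_map (top_of_set (C \<times> C)) X (f \<circ> snd)"
    by (rule continuous_map_compose[OF _ f]; auto intro!: continuous_intros)+
  have "closedin (top_of_set (C \<times> C)) {z \<in> topspace (top_of_set (C \<times> C)). (f \<circ> fst) z = (f \<circ> snd) z}"
    by (rule closedin_continuous_maps_eq[OF X fst_snd])
  then have "compact {z \<in> C \<times> C. f (fst z) = f (snd z)}"
    using closedin_compact[OF compact_Times[OF \<open>compact C\<close> \<open>compact C\<close>]] by simp
  then have "compact D"
    unfolding D_def by (intro compact_Times) auto
  have j: "continuous_on D j"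
    unfolding j_def case_prod_unfold by (intro continuous_intros)
  have "compact \<Lambda>"
    unfolding \<Lambda>_def using j \<open>compact D\<close> by (rule compact_continuous_image)
  have q: "q (j z) = f (fst (fst z))" if "z \<in> D" for z
    using that unfolding q_def D_def j_def by auto
  have "quotient_map (top_of_set D) (top_of_set \<Lambda>) j"
  proof (rule continuous_imp_quotient_map)
    show "continuous_map (top_of_set D) (top_of_set \<Lambda>) j" using j by (auto simp: \<Lambda>_def)
    show "compact_space (top_of_set D)" using \<open>compact D\<close> by (simp add: compact_space_subtopology)
    show "Hausdorff_space (top_of_set \<Lambda>)" by (simp add: Hausdorff_space_subtopology)
  qed (auto simp: \<Lambda>_def)
  moreover have "continuous_map (top_of_set D) X (q \<circ> j)"
  proof (rule continuous_map_eq)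
    show "continuous_map (top_of_set D) X (f \<circ> (fst \<circ> fst))"
      by (rule continuous_map_compose[OF _ f]) (auto simp: D_def intro!: continuous_intros)
  qed (simp add: q)
  ultimately have qc: "continuous_map (top_of_set \<Lambda>) X q"
    by (rule continuous_compose_quotient_map)
  have "q ` \<Lambda> = topspace X"
  proof -
    have "q ` \<Lambda> = (\<lambda>z. f (fst (fst z))) ` D" unfolding \<Lambda>_def image_image by (simp add: q)
    also have "\<dots> = f ` C"
    proof (intro equalityI subsetI)
      fix p assume "p \<in> f ` C"
      then obtain c where "c \<in> C" "p = f c" by blast
      then show "p \<in> (\<lambda>z. f (fst (fst z))) ` D"
        by (intro image_eqI[of _ _ "((c, c), 0)"]) (auto simp: D_def)
    qed (auto simp: D_def)
    finally show ?thesis using surj by simp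
  qed
  have quot: "quotient_map (top_of_set \<Lambda>) X q"
    using qc X \<open>q ` \<Lambda> = topspace X\<close> \<open>compact \<Lambda>\<close>
    by (intro continuous_imp_quotient_map) (auto simp: compact_space_subtopology)
  have "connected {y \<in> \<Lambda>. q y = p}" if "p \<in> topspace X" for p
  proof -
    let ?F = "{a \<in> C. f a = p}"
    have "{y \<in> \<Lambda>. q y = p} = j ` {z \<in> D. f (fst (fst z)) = p}"
      unfolding \<Lambda>_def using q by auto
    also have "{z \<in> D. f (fst (fst z)) = p} = (?F \<times> ?F) \<times> {0..1}"
      unfolding D_def by auto
    also have "j ` ((?F \<times> ?F) \<times> {0..1}) =
        {join_point a b t | a b t. a \<in> ?F \<and> b \<in> ?F \<and> t \<in> {0..1}}"
      unfolding j_def by (simp only: image_def Bex_def mem_Times_iff split_paired_Ex) auto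
    finally have join: "{y \<in> \<Lambda>. q y = p} =
        {join_point a b t | a b t. a \<in> ?F \<and> b \<in> ?F \<and> t \<in> {0..1}}" .
    have "p \<in> f ` C" using that surj by simp
    then have "?F \<noteq> {}" by blast
    then show ?thesis unfolding join by (rule connected_join_of_sets)
  qed
  then show ?thesis using \<open>compact \<Lambda>\<close> quot by blast
qed

text \<open>The binary digit number \<open>prod_encode (m, k)\<close> says whether \<open>a m = k\<close>, and the digits are read in
  base three, so that no two digit sequences give the same number. This embeds the Baire space
  continuously in the line.\<close>
definition ternary_code :: "(nat \<Rightarrow> nat) \<Rightarrow> real" where
  "ternary_code a = (\<Sum>n. if a (fst (prod_decode n)) = snd (prod_decode n) then (1/3) ^ n else 0)"

text \<open>At the first place \<open>k\<close> where the digits differ, the difference \<open>3\<^sup>-\<^sup>k\<close> exceeds everything that the later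
  places can contribute, which is at most half of it.\<close>
lemma ternary_digits_inj:
  fixes A B :: "nat set"
  assumes "(\<Sum>n. if n \<in> A then (1/3::real) ^ n else 0) = (\<Sum>n. if n \<in> B then (1/3) ^ n else 0)"
  shows "A = B"
proof (rule ccontr)
  assume "A \<noteq> B"
  define h where "h n = (if n \<in> A then (1/3::real) ^ n else 0) - (if n \<in> B then (1/3) ^ n else 0)" for n
  have sm: "summable (\<lambda>n. if n \<in> D then (1/3::real) ^ n else 0)" for D
    by (rule summable_comparison_test'[OF summable_geometric[of "1/3::real"], of 0]) auto
  have h: "summable h" "suminf h = 0"
    unfolding h_def using suminf_diff[OF sm sm, of A B] summable_diff[OF sm sm, of A B] assms by simp_all
  define k where "k = (LEAST n. (n \<in> A) \<noteq> (n \<in> B))"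
  have k: "(k \<in> A) \<noteq> (k \<in> B)"
    unfolding k_def by (rule LeastI_ex) (use \<open>A \<noteq> B\<close> in \<open>simp add: set_eq_iff\<close>)
  have below: "(n \<in> A) = (n \<in> B)" if "n < k" for n
    using not_less_Least[OF that[unfolded k_def]] by simp
  have "0 = (\<Sum>n. h (n + Suc k)) + (\<Sum>n<Suc k. h n)"
    using suminf_split_initial_segment[OF h(1), of "Suc k"] h(2) by simp
  also have "(\<Sum>n<Suc k. h n) = h k"
    using below by (simp add: h_def)
  finally have "\<bar>h k\<bar> = \<bar>\<Sum>n. h (n + Suc k)\<bar>" by linarith
  also have "\<dots> \<le> (\<Sum>n. (1/3) ^ (n + Suc k))"
  proof -
    have "summable (\<lambda>n. (1/3::real) ^ (n + Suc k))"
      using summable_ignore_initial_segment[OF summable_geometric[of "1/3::real"], of "Suc k"] by simp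
    then have "norm (\<Sum>n. h (n + Suc k)) \<le> (\<Sum>n. (1/3) ^ (n + Suc k))"
      by (intro norm_suminf_le) (auto simp: h_def)
    then show ?thesis by simp
  qed
  also have "\<dots> = (1/3) ^ Suc k * (\<Sum>n. (1/3) ^ n)"
    by (subst suminf_mult[symmetric]) (auto simp: power_add ac_simps)
  also have "\<dots> = (1/3) ^ k / 2"
    by (subst suminf_geometric) auto
  also have "\<dots> < (1/3) ^ k" by simp
  also have "\<dots> = \<bar>h k\<bar>" using k by (auto simp: h_def)
  finally show False by simp
qed

lemma inj_ternary_code: "inj ternary_code"
proof (rule injI)
  fix a b assume "ternary_code a = ternary_code b"
  then have "{n. a (fst (prod_decode n)) = snd (prod_decode n)} = {n. b (fst (prod_decode n)) = snd (prod_decode n)}"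
    by (intro ternary_digits_inj) (simp add: ternary_code_def)
  moreover have "prod_encode (m, a m) \<in> {n. a (fst (prod_decode n)) = snd (prod_decode n)}" for m
    by simp
  ultimately have "prod_encode (m, a m) \<in> {n. b (fst (prod_decode n)) = snd (prod_decode n)}" for m
    by (simp only:)
  then have "b m = a m" for m by (simp only: mem_Collect_eq prod_encode_inverse fst_conv snd_conv)
  then show "a = b" by (intro ext) (rule sym)
qed

lemma continuous_on_ternary_code: "continuous_on A ternary_code"
proof -
  define g where "g n a = (if a (fst (prod_decode n)) = snd (prod_decode n) then (1/3) ^ n else (0::real))"
    for n and a :: "nat \<Rightarrow> nat"
  have "uniform_limit A (\<lambda>N a. \<Sum>n<N. g n a) (\<lambda>a. \<Sum>n. g n a) sequentially"
    by (rule Weierstrass_m_test[where M = "\<lambda>n. (1/3) ^ n"]) (auto simp: g_def intro!: summable_geometric)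
  moreover have "continuous_on A (\<lambda>a. \<Sum>n<N. g n a)" for N
  proof (rule continuous_on_sum)
    fix n
    let ?k = "\<lambda>c. if c = snd (prod_decode n) then (1/3) ^ n else (0::real)"
    have "continuous_on UNIV ?k" by simp
    moreover have "continuous_on A (\<lambda>a :: nat \<Rightarrow> nat. a (fst (prod_decode n)))"
      by (rule continuous_on_subset[OF continuous_on_product_coordinates]) simp
    ultimately have "continuous_on A (\<lambda>a. ?k (a (fst (prod_decode n))))"
      by (rule continuous_on_compose2) auto
    then show "continuous_on A (g n)" by (simp add: g_def[abs_def])
  qed
  ultimately have "continuous_on A (\<lambda>a. \<Sum>n. g n a)"
    by (intro uniform_limit_theorem) auto
  then show ?thesis by (simp add: ternary_code_def[abs_def] g_def)
qed

text \<open>On a compact set the code is a homeomorphism onto a compact set of reals, so the join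
  construction applies.\<close>
corollary monotone_quotient_of_compact_Baire_set:
  fixes A :: "(nat \<Rightarrow> nat) set" and f :: "(nat \<Rightarrow> nat) \<Rightarrow> 'a"
  assumes "compact A" and f: "continuous_map (top_of_set A) X f"
    and surj: "f ` A = topspace X" and X: "Hausdorff_space X"
  shows "\<exists>(\<Lambda> :: (real ^ 3) set) q. compact \<Lambda> \<and> quotient_map (top_of_set \<Lambda>) X q \<and>
    (\<forall>p\<in>topspace X. connected {y \<in> \<Lambda>. q y = p})"
proof (rule monotone_quotient_of_compact_subset_R3)
  let ?decode = "the_inv_into A ternary_code"
  have inj: "inj_on ternary_code A"
    using inj_ternary_code by (simp add: inj_on_def inj_def)
  show "compact (ternary_code ` A)"
    by (rule compact_continuous_image[OF continuous_on_ternary_code \<open>compact A\<close>])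
  have "continuous_on (ternary_code ` A) ?decode"
    by (rule continuous_on_inv_into[OF continuous_on_ternary_code \<open>compact A\<close> inj])
  then show "continuous_map (top_of_set (ternary_code ` A)) X (f \<circ> ?decode)"
    by (intro continuous_map_compose[OF _ f]) (auto simp: image_subset_iff the_inv_into_f_f[OF inj])
  show "(f \<circ> ?decode) ` (ternary_code ` A) = topspace X"
    unfolding image_image surj[symmetric] by (intro image_cong) (simp_all add: the_inv_into_f_f[OF inj])
qed (rule X)

section \<open>Discrete geodesic spaces\<close>

text \<open>The vertex set of a connected graph with its path metric: by \<open>first_step\<close> every distance is
  realized by a path of unit steps.\<close>
locale discrete_geodesic_space =
  fixes X :: "'a set" and d :: "'a \<Rightarrow> 'a \<Rightarrow> nat"
  assumes dist_eq_0: "x \<in> X \<Longrightarrow> y \<in> X \<Longrightarrow> d x y = 0 \<longleftrightarrow> x = y"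
    and dist_sym: "x \<in> X \<Longrightarrow> y \<in> X \<Longrightarrow> d x y = d y x"
    and dist_triangle: "x \<in> X \<Longrightarrow> y \<in> X \<Longrightarrow> z \<in> X \<Longrightarrow> d x z \<le> d x y + d y z"
    and first_step: "x \<in> X \<Longrightarrow> y \<in> X \<Longrightarrow> d x y = Suc n \<Longrightarrow> \<exists>z\<in>X. d x z = 1 \<and> d z y = n"
begin

definition geodesic :: "(nat \<Rightarrow> 'a) \<Rightarrow> nat \<Rightarrow> bool" where
  "geodesic \<gamma> n \<longleftrightarrow> (\<forall>i\<le>n. \<gamma> i \<in> X) \<and> (\<forall>i j. i \<le> j \<and> j \<le> n \<longrightarrow> d (\<gamma> i) (\<gamma> j) = j - i)"

lemma geodesicD:
  assumes "geodesic \<gamma> n"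
  shows "i \<le> n \<Longrightarrow> \<gamma> i \<in> X" "i \<le> j \<Longrightarrow> j \<le> n \<Longrightarrow> d (\<gamma> i) (\<gamma> j) = j - i"
  using assms by (auto simp: geodesic_def)

lemma path_dist_le:
  assumes "\<And>i. i \<le> n \<Longrightarrow> \<gamma> i \<in> X" "\<And>i. i < n \<Longrightarrow> d (\<gamma> i) (\<gamma> (Suc i)) \<le> 1" "i \<le> j" "j \<le> n"
  shows "d (\<gamma> i) (\<gamma> j) \<le> j - i"
  using \<open>i \<le> j\<close> \<open>j \<le> n\<close>
proof (induction j rule: dec_induct)
  case base
  then show ?case using assms(1) dist_eq_0 by simp
next
  case (step j)
  have "d (\<gamma> i) (\<gamma> (Suc j)) \<le> d (\<gamma> i) (\<gamma> j) + d (\<gamma> j) (\<gamma> (Suc j))"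
    using step.hyps step.prems by (intro dist_triangle assms(1)) auto
  also have "\<dots> \<le> (j - i) + 1"
    using step assms(2)[of j] by (intro add_mono) auto
  finally show ?case using step.hyps by simp
qed

text \<open>The triangle inequality leaves no slack in a path whose number of steps equals the distance of its
  ends.\<close>
lemma short_path_geodesic:
  assumes "\<And>i. i \<le> n \<Longrightarrow> \<gamma> i \<in> X" "\<And>i. i < n \<Longrightarrow> d (\<gamma> i) (\<gamma> (Suc i)) \<le> 1" "d (\<gamma> 0) (\<gamma> n) = n"
  shows "geodesic \<gamma> n"
  unfolding geodesic_def
proof (intro conjI allI impI)
  fix i j assume ij: "i \<le> j \<and> j \<le> n"
  note le = path_dist_le[of n \<gamma>, OF assms(1,2)]
  have "d (\<gamma> 0) (\<gamma> n) \<le> d (\<gamma> 0) (\<gamma> i) + d (\<gamma> i) (\<gamma> n)"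
    using ij by (intro dist_triangle assms(1)) auto
  moreover have "d (\<gamma> i) (\<gamma> n) \<le> d (\<gamma> i) (\<gamma> j) + d (\<gamma> j) (\<gamma> n)"
    using ij by (intro dist_triangle assms(1)) auto
  ultimately have "n \<le> d (\<gamma> 0) (\<gamma> i) + d (\<gamma> i) (\<gamma> j) + d (\<gamma> j) (\<gamma> n)"
    using assms(3) by linarith
  then show "d (\<gamma> i) (\<gamma> j) = j - i"
    using le[of 0 i] le[of i j] le[of j n] ij by linarith
qed (use assms in auto)

lemma geodesic_exists:
  assumes "x \<in> X" "y \<in> X"
  obtains \<gamma> where "geodesic \<gamma> (d x y)" "\<gamma> 0 = x" "\<gamma> (d x y) = y"
proof -
  have "\<exists>\<gamma>. (\<forall>i\<le>n. \<gamma> i \<in> X) \<and> (\<forall>i<n. d (\<gamma> i) (\<gamma> (Suc i)) \<le> 1) \<and> \<gamma> 0 = x \<and> \<gamma> n = y"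
    if "d x y = n" for n
    using that \<open>x \<in> X\<close>
  proof (induction n arbitrary: x)
    case 0
    then show ?case using dist_eq_0 \<open>y \<in> X\<close> by (intro exI[of _ "\<lambda>_. x"]) auto
  next
    case (Suc n)
    obtain z where z: "z \<in> X" "d x z = 1" "d z y = n"
      using first_step[OF Suc.prems(2) \<open>y \<in> X\<close> Suc.prems(1)] by blast
    obtain \<gamma> where g: "\<forall>i\<le>n. \<gamma> i \<in> X" "\<forall>i<n. d (\<gamma> i) (\<gamma> (Suc i)) \<le> 1" "\<gamma> 0 = z" "\<gamma> n = y"
      using Suc.IH[OF z(3,1)] by blast
    let ?\<gamma> = "case_nat x \<gamma>"
    have "?\<gamma> i \<in> X" if "i \<le> Suc n" for i
      using that g(1) Suc.prems(2) by (cases i) auto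
    moreover have "d (?\<gamma> i) (?\<gamma> (Suc i)) \<le> 1" if "i < Suc n" for i
      using that g(2,3) z(2) by (cases i) auto
    ultimately show ?case using g(4) by (intro exI[of _ ?\<gamma>]) simp
  qed
  then obtain \<gamma> where "\<forall>i\<le>d x y. \<gamma> i \<in> X" "\<forall>i<d x y. d (\<gamma> i) (\<gamma> (Suc i)) \<le> 1" "\<gamma> 0 = x" "\<gamma> (d x y) = y"
    by blast
  with that show thesis using short_path_geodesic[of "d x y" \<gamma>] by simp
qed

lemma point_at_distance:
  assumes "x \<in> X" "y \<in> X" "k \<le> d x y"
  obtains z where "z \<in> X" "d x z = k" "d z y = d x y - k"
proof -
  obtain \<gamma> where g: "geodesic \<gamma> (d x y)" "\<gamma> 0 = x" "\<gamma> (d x y) = y"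
    using geodesic_exists[OF assms(1,2)] .
  show thesis
    using that[of "\<gamma> k"] geodesicD[OF g(1), of k] geodesicD(2)[OF g(1), of 0 k]
      geodesicD(2)[OF g(1), of k "d x y"] assms(3) g(2,3) by auto
qed

abbreviation gp :: "'a \<Rightarrow> 'a \<Rightarrow> 'a \<Rightarrow> real" where
  "gp \<equiv> gromov_product (\<lambda>x y. real (d x y))"

lemma gp_sym: "x \<in> X \<Longrightarrow> y \<in> X \<Longrightarrow> gp w x y = gp w y x"
  by (simp add: gromov_product_def dist_sym)

lemma gp_le_dist:
  assumes "w \<in> X" "x \<in> X" "y \<in> X"
  shows "gp w x y \<le> d w x"
  using dist_triangle[of y x w] assms by (simp add: gromov_product_def dist_sym)

end

section \<open>The boundary under a coarse ultrametric inequality\<close>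

text \<open>A proper space in which Gromov products at the base point obey a qualitative ultrametric
  inequality: a large product is forced by two sufficiently large ones, with no control on the loss.
  Unlike the inequality with an additive constant, this form follows at once for a metric whose
  Gromov products are only known up to multiplicative constants.\<close>
locale hyperbolic_at_infinity = discrete_geodesic_space +
  fixes w :: 'a
  assumes base: "w \<in> X"
    and finite_balls: "finite {x \<in> X. d w x \<le> n}"
    and coarsely_ultrametric: "\<exists>s. \<forall>x\<in>X. \<forall>y\<in>X. \<forall>z\<in>X. s \<le> gp w x y \<and> s \<le> gp w y z \<longrightarrow> r \<le> gp w x z"
begin

abbreviation "rdist \<equiv> \<lambda>x y. real (d x y)"

text \<open>All convergence conditions on Gromov products in the definition of the boundary are expressed by
  this single relation, up to an error of 1 in the case of the lower limit.\<close>
definition near :: "real \<Rightarrow> (nat \<Rightarrow> 'a) \<Rightarrow> (nat \<Rightarrow> 'a) \<Rightarrow> bool" where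
  "near r u v \<longleftrightarrow> (\<exists>N. \<forall>i\<ge>N. \<forall>j\<ge>N. r \<le> gp w (u i) (v j))"

lemma near_sym:
  assumes "near r u v" "range u \<subseteq> X" "range v \<subseteq> X"
  shows "near r v u"
proof -
  have "gp w (u i) (v j) = gp w (v j) (u i)" for i j using assms(2,3) by (intro gp_sym) auto
  then show ?thesis using assms(1) unfolding near_def by metis
qed

lemma near_trans:
  obtains s where "\<And>u v z. near s u v \<Longrightarrow> near s v z \<Longrightarrow>
    range u \<subseteq> X \<Longrightarrow> range v \<subseteq> X \<Longrightarrow> range z \<subseteq> X \<Longrightarrow> near r u z"
proof -
  obtain s where s: "\<And>x y z. x \<in> X \<Longrightarrow> y \<in> X \<Longrightarrow> z \<in> X \<Longrightarrow> s \<le> gp w x y \<Longrightarrow> s \<le> gp w y z \<Longrightarrow> r \<le> gp w x z"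
    using coarsely_ultrametric[of r] by blast
  show thesis
  proof (rule that)
    fix u v z assume *: "near s u v" "near s v z" "range u \<subseteq> X" "range v \<subseteq> X" "range z \<subseteq> X"
    obtain M where M: "\<forall>i\<ge>M. \<forall>j\<ge>M. s \<le> gp w (u i) (v j)" using * unfolding near_def by blast
    obtain N where N: "\<forall>i\<ge>N. \<forall>j\<ge>N. s \<le> gp w (v i) (z j)" using * unfolding near_def by blast
    show "near r u z"
      unfolding near_def
    proof (intro exI allI impI)
      fix i j assume "max M N \<le> i" "max M N \<le> j"
      then show "r \<le> gp w (u i) (z j)"
        using M N *(3-5) by (intro s[of _ "v (max M N)"]) auto
    qed
  qed
qed

lemma filterlim_gp_iff:
  "filterlim (\<lambda>(i, j). gp w (u i) (v j)) at_top (sequentially \<times>\<^sub>F sequentially) \<longleftrightarrow> (\<forall>r. near r u v)"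
  by (simp add: filterlim_at_top eventually_prod_sequentially near_def) (metis (no_types, lifting))

lemma sequences_to_infinity_iff:
  "u \<in> sequences_to_infinity X rdist w \<longleftrightarrow> range u \<subseteq> X \<and> (\<forall>r. near r u u)"
  by (simp add: sequences_to_infinity_def filterlim_gp_iff)

lemma boundary_equiv_iff:
  "(u, v) \<in> boundary_equiv X rdist w \<longleftrightarrow> u \<in> sequences_to_infinity X rdist w \<and>
     v \<in> sequences_to_infinity X rdist w \<and> (\<forall>r. near r u v)"
  by (simp add: boundary_equiv_def filterlim_gp_iff)

lemma Liminf_gp_near:
  assumes "ereal r \<le> Liminf (sequentially \<times>\<^sub>F sequentially) (\<lambda>(i, j). ereal (gp w (u i) (v j)))"
  shows "near (r - 1) u v"
proof -
  have "ereal (r - 1) < ereal r" by simp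
  then have "eventually (\<lambda>p. ereal (r - 1) < (\<lambda>(i, j). ereal (gp w (u i) (v j))) p) (sequentially \<times>\<^sub>F sequentially)"
    using assms unfolding le_Liminf_iff by blast
  then show ?thesis
    unfolding near_def eventually_prod_sequentially by (auto intro: less_imp_le)
qed

lemma near_Liminf_gp:
  assumes "near r u v"
  shows "ereal r \<le> Liminf (sequentially \<times>\<^sub>F sequentially) (\<lambda>(i, j). ereal (gp w (u i) (v j)))"
  using assms unfolding near_def by (intro Liminf_bounded) (auto simp: eventually_prod_sequentially)

lemma equiv_boundary_equiv: "equiv (sequences_to_infinity X rdist w) (boundary_equiv X rdist w)"
proof (rule equivI)
  show "boundary_equiv X rdist w \<subseteq> sequences_to_infinity X rdist w \<times> sequences_to_infinity X rdist w"
    by (auto simp: boundary_equiv_iff)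
  show "refl_on (sequences_to_infinity X rdist w) (boundary_equiv X rdist w)"
    by (auto simp: refl_on_def boundary_equiv_iff sequences_to_infinity_iff)
  show "sym (boundary_equiv X rdist w)"
    by (auto simp: sym_def boundary_equiv_iff sequences_to_infinity_iff intro: near_sym)
  show "trans (boundary_equiv X rdist w)"
  proof (rule transI)
    fix u v z assume *: "(u, v) \<in> boundary_equiv X rdist w" "(v, z) \<in> boundary_equiv X rdist w"
    have "near r u z" for r
    proof -
      obtain s where "\<And>u v z. near s u v \<Longrightarrow> near s v z \<Longrightarrow>
        range u \<subseteq> X \<Longrightarrow> range v \<subseteq> X \<Longrightarrow> range z \<subseteq> X \<Longrightarrow> near r u z"
        using near_trans[of r] by blast
      from this[of u v z] * show ?thesis by (auto simp: boundary_equiv_iff sequences_to_infinity_iff)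
    qed
    then show "(u, z) \<in> boundary_equiv X rdist w" using * by (simp add: boundary_equiv_iff)
  qed
qed

lemma boundary_point_elems:
  assumes "p \<in> boundary_points X rdist w" "u \<in> p"
  shows "u \<in> sequences_to_infinity X rdist w" "range u \<subseteq> X"
    "p = boundary_equiv X rdist w `` {u}"
proof -
  show "u \<in> sequences_to_infinity X rdist w"
    using assms in_quotient_imp_subset[OF equiv_boundary_equiv] unfolding boundary_points_def by blast
  then show "range u \<subseteq> X" by (simp add: sequences_to_infinity_iff)
  show "p = boundary_equiv X rdist w `` {u}"
  proof -
    obtain v where v: "p = boundary_equiv X rdist w `` {v}"
      using assms(1) unfolding boundary_points_def by (rule quotientE)
    then have "(v, u) \<in> boundary_equiv X rdist w" using assms(2) by simp
    then show ?thesis using v equiv_class_eq[OF equiv_boundary_equiv] by simp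
  qed
qed

lemma boundary_point_near:
  assumes "p \<in> boundary_points X rdist w" "u \<in> p" "v \<in> p"
  shows "near r u v"
  using boundary_point_elems(3)[OF assms(1,2)] assms(3) by (simp add: boundary_equiv_iff)

lemma boundary_point_nonempty:
  assumes "p \<in> boundary_points X rdist w"
  obtains u where "u \<in> p"
  using assms in_quotient_imp_non_empty[OF equiv_boundary_equiv] unfolding boundary_points_def by blast

lemma boundary_nhdI:
  assumes "q \<in> boundary_points X rdist w" "u \<in> p" "v \<in> q" "near r u v"
  shows "q \<in> boundary_nhd X rdist w p r"
  using assms near_Liminf_gp unfolding boundary_nhd_def by blast

text \<open>Membership in a basic neighbourhood is witnessed by some pair of representing sequences; a larger
  radius makes all pairs satisfy the estimate, since equivalent sequences can be inserted at both
  ends.\<close>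
lemma boundary_nhd_near:
  obtains s where "\<And>p q u v. p \<in> boundary_points X rdist w \<Longrightarrow> q \<in> boundary_nhd X rdist w p s \<Longrightarrow>
    u \<in> p \<Longrightarrow> v \<in> q \<Longrightarrow> near r u v"
proof -
  obtain s where s: "\<And>u v z. near s u v \<Longrightarrow> near s v z \<Longrightarrow>
    range u \<subseteq> X \<Longrightarrow> range v \<subseteq> X \<Longrightarrow> range z \<subseteq> X \<Longrightarrow> near r u z"
    using near_trans[of r] by blast
  obtain t where t: "\<And>u v z. near t u v \<Longrightarrow> near t v z \<Longrightarrow>
    range u \<subseteq> X \<Longrightarrow> range v \<subseteq> X \<Longrightarrow> range z \<subseteq> X \<Longrightarrow> near s u z"
    using near_trans[of s] by blast
  show thesis
  proof (rule that)
    fix p q u v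
    assume p: "p \<in> boundary_points X rdist w" and "q \<in> boundary_nhd X rdist w p (t + 1)"
      and uv: "u \<in> p" "v \<in> q"
    then obtain u' v' where q: "q \<in> boundary_points X rdist w" and uv': "u' \<in> p" "v' \<in> q"
      and "ereal (t + 1) \<le> Liminf (sequentially \<times>\<^sub>F sequentially) (\<lambda>(i, j). ereal (gp w (u' i) (v' j)))"
      unfolding boundary_nhd_def by blast
    then have "near t u' v'" using Liminf_gp_near[of "t + 1" u' v'] by simp
    then have "near s u v'"
      using t[of u u' v'] boundary_point_near[OF p uv(1) uv'(1)] boundary_point_elems(2)[OF p]
        boundary_point_elems(2)[OF q] uv uv' by blast
    then show "near r u v"
      using s[of u v' v] boundary_point_near[OF q uv'(2) uv(2)] boundary_point_elems(2)[OF p]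
        boundary_point_elems(2)[OF q] uv uv' by blast
  qed
qed

lemma boundary_nhd_self:
  assumes "p \<in> boundary_points X rdist w"
  shows "p \<in> boundary_nhd X rdist w p r"
proof -
  obtain u where "u \<in> p" using boundary_point_nonempty[OF assms] .
  then show ?thesis using boundary_nhdI[OF assms] boundary_point_near[OF assms] by blast
qed

lemma boundary_nhd_trans:
  obtains s where "\<And>p q z. p \<in> boundary_points X rdist w \<Longrightarrow> q \<in> boundary_nhd X rdist w p s \<Longrightarrow>
    z \<in> boundary_nhd X rdist w q s \<Longrightarrow> z \<in> boundary_nhd X rdist w p r"
proof -
  obtain t where t: "\<And>u v z. near t u v \<Longrightarrow> near t v z \<Longrightarrow>
    range u \<subseteq> X \<Longrightarrow> range v \<subseteq> X \<Longrightarrow> range z \<subseteq> X \<Longrightarrow> near r u z"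
    using near_trans[of r] by blast
  obtain s where s: "\<And>p q u v. p \<in> boundary_points X rdist w \<Longrightarrow> q \<in> boundary_nhd X rdist w p s \<Longrightarrow>
    u \<in> p \<Longrightarrow> v \<in> q \<Longrightarrow> near t u v"
    using boundary_nhd_near[of t] by blast
  show thesis
  proof (rule that)
    fix p q z
    assume p: "p \<in> boundary_points X rdist w" and qn: "q \<in> boundary_nhd X rdist w p s"
      and zn: "z \<in> boundary_nhd X rdist w q s"
    have q: "q \<in> boundary_points X rdist w" and z: "z \<in> boundary_points X rdist w"
      using qn zn by (auto simp: boundary_nhd_def)
    obtain a b c where abc: "a \<in> p" "b \<in> q" "c \<in> z"
      using boundary_point_nonempty p q z by metis
    have "near r a c"
      using t[of a b c] s[OF p qn abc(1,2)] s[OF q zn abc(2,3)] abc p q z boundary_point_elems(2) by blast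
    then show "z \<in> boundary_nhd X rdist w p r"
      using boundary_nhdI[OF z] abc by blast
  qed
qed

text \<open>The basic neighbourhoods need not be open. The points all of whose sufficiently small
  neighbourhoods lie inside form an open set because of \<open>boundary_nhd_trans\<close>.\<close>
lemma boundary_nhd_interior:
  assumes p: "p \<in> boundary_points X rdist w"
  obtains U where "openin (boundary_top X rdist w) U" "p \<in> U" "U \<subseteq> boundary_nhd X rdist w p r"
proof -
  define U where "U = {x \<in> boundary_points X rdist w. \<exists>s. boundary_nhd X rdist w x s \<subseteq> boundary_nhd X rdist w p r}"
  have "\<exists>s. boundary_nhd X rdist w x s \<subseteq> U" if "x \<in> U" for x
  proof -
    obtain r' where x: "x \<in> boundary_points X rdist w" and r': "boundary_nhd X rdist w x r' \<subseteq> boundary_nhd X rdist w p r"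
      using \<open>x \<in> U\<close> unfolding U_def by blast
    obtain s where s: "\<And>p q z. p \<in> boundary_points X rdist w \<Longrightarrow> q \<in> boundary_nhd X rdist w p s \<Longrightarrow>
      z \<in> boundary_nhd X rdist w q s \<Longrightarrow> z \<in> boundary_nhd X rdist w p r'"
      using boundary_nhd_trans[of r'] by blast
    have "y \<in> U" if "y \<in> boundary_nhd X rdist w x s" for y
      using that s[OF x that] r' unfolding U_def boundary_nhd_def by blast
    then show ?thesis by blast
  qed
  then have "openin (boundary_top X rdist w) U"
    unfolding openin_boundary_top U_def by blast
  moreover have "p \<in> U" using p unfolding U_def by blast
  moreover have "U \<subseteq> boundary_nhd X rdist w p r"
    unfolding U_def using boundary_nhd_self by blast
  ultimately show thesis using that by blast
qed

text \<open>If all neighbourhoods of two points met, inserting a common point would show that the points are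
  represented by equivalent sequences.\<close>
lemma Hausdorff_boundary: "Hausdorff_space (boundary_top X rdist w)"
  unfolding Hausdorff_space_def topspace_boundary_top
proof (intro allI impI)
  fix p q
  assume "p \<in> boundary_points X rdist w \<and> q \<in> boundary_points X rdist w \<and> p \<noteq> q"
  then have p: "p \<in> boundary_points X rdist w" and q: "q \<in> boundary_points X rdist w" and "p \<noteq> q" by auto
  obtain u v where u: "u \<in> p" and v: "v \<in> q" using p q boundary_point_nonempty by metis
  have X: "range u \<subseteq> X" "range v \<subseteq> X" using u v p q boundary_point_elems(2) by blast+
  have "\<not> (\<forall>r. near r u v)"
  proof
    assume "\<forall>r. near r u v"
    then have "(u, v) \<in> boundary_equiv X rdist w"
      using boundary_point_elems(1) p q u v by (simp add: boundary_equiv_iff)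
    then have "p = q"
      using boundary_point_elems(3)[OF p u] boundary_point_elems(3)[OF q v]
        equiv_class_eq[OF equiv_boundary_equiv] by simp
    then show False using \<open>p \<noteq> q\<close> by blast
  qed
  then obtain r where r: "\<not> near r u v" by blast
  obtain t where t: "\<And>u v z. near t u v \<Longrightarrow> near t v z \<Longrightarrow>
    range u \<subseteq> X \<Longrightarrow> range v \<subseteq> X \<Longrightarrow> range z \<subseteq> X \<Longrightarrow> near r u z"
    using near_trans[of r] by blast
  obtain s where s: "\<And>p q u v. p \<in> boundary_points X rdist w \<Longrightarrow> q \<in> boundary_nhd X rdist w p s \<Longrightarrow>
    u \<in> p \<Longrightarrow> v \<in> q \<Longrightarrow> near t u v"
    using boundary_nhd_near[of t] by blast
  have disj: "boundary_nhd X rdist w p s \<inter> boundary_nhd X rdist w q s = {}"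
  proof (rule ccontr)
    assume "\<not> ?thesis"
    then obtain z where zp: "z \<in> boundary_nhd X rdist w p s" and zq: "z \<in> boundary_nhd X rdist w q s" by blast
    then have z: "z \<in> boundary_points X rdist w" by (simp add: boundary_nhd_def)
    obtain c where c: "c \<in> z" using boundary_point_nonempty[OF z] .
    have cX: "range c \<subseteq> X" using boundary_point_elems(2)[OF z c] .
    have "near t u c" using s[OF p zp u c] .
    moreover have "near t c v" using near_sym[OF s[OF q zq v c] X(2) cX] .
    ultimately have "near r u v" using t X cX by blast
    then show False using r by blast
  qed
  obtain U where "openin (boundary_top X rdist w) U" "p \<in> U" "U \<subseteq> boundary_nhd X rdist w p s"
    using boundary_nhd_interior[OF p] .
  moreover obtain V where "openin (boundary_top X rdist w) V" "q \<in> V" "V \<subseteq> boundary_nhd X rdist w q s"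
    using boundary_nhd_interior[OF q] .
  ultimately show "\<exists>U V. openin (boundary_top X rdist w) U \<and> openin (boundary_top X rdist w) V \<and>
      p \<in> U \<and> q \<in> V \<and> disjnt U V"
    using disj unfolding disjnt_def by blast
qed

end

section \<open>The boundary as a space of geodesic rays\<close>

lemma open_cylinder: "open {b :: nat \<Rightarrow> nat. \<forall>i\<le>n. b i = a i}"
proof -
  have "open ((\<lambda>b :: nat \<Rightarrow> nat. b i) -` {a i})" for i
    by (intro open_vimage continuous_on_product_coordinates open_discrete)
  then have "open (\<Inter>i\<in>{..n}. (\<lambda>b :: nat \<Rightarrow> nat. b i) -` {a i})"
    by (intro open_INT) auto
  also have "(\<Inter>i\<in>{..n}. (\<lambda>b :: nat \<Rightarrow> nat. b i) -` {a i}) = {b. \<forall>i\<le>n. b i = a i}"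
    by auto
  finally show ?thesis .
qed

text \<open>A set of sequences is open if membership of each of its elements is decided by finitely many
  terms.\<close>
lemma open_if_cylinders:
  fixes U :: "(nat \<Rightarrow> nat) set"
  assumes "\<And>a. a \<in> U \<Longrightarrow> \<exists>n. \<forall>b. (\<forall>i\<le>n. b i = a i) \<longrightarrow> b \<in> U"
  shows "open U"
proof (subst open_subopen, intro ballI)
  fix a assume "a \<in> U"
  then obtain n where n: "\<And>b. \<forall>i\<le>n. b i = a i \<Longrightarrow> b \<in> U" using assms by blast
  show "\<exists>T. open T \<and> a \<in> T \<and> T \<subseteq> U"
    using n by (intro exI[of _ "{b. \<forall>i\<le>n. b i = a i}"]) (auto simp: open_cylinder)
qed

lemma compact_finite_branching:
  fixes F :: "nat \<Rightarrow> nat set"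
  assumes "\<And>n. finite (F n)"
  shows "compact {a. \<forall>n. a n \<in> F n}"
proof -
  have "compactin (product_topology (\<lambda>_. euclidean) UNIV) (PiE UNIV F)"
    using assms by (simp add: compactin_PiE finite_imp_compact)
  moreover have "PiE UNIV F = {a. \<forall>n. a n \<in> F n}" by (auto simp: PiE_def Pi_def)
  ultimately show ?thesis by (simp add: euclidean_product_topology)
qed

context hyperbolic_at_infinity
begin

definition rays :: "(nat \<Rightarrow> 'a) set" where
  "rays = {\<rho>. \<rho> 0 = w \<and> (\<forall>n. geodesic \<rho> n)}"

definition endpoint :: "(nat \<Rightarrow> 'a) \<Rightarrow> (nat \<Rightarrow> 'a) set" where
  "endpoint \<rho> = boundary_equiv X rdist w `` {\<rho>}"

lemma raysD:
  assumes "\<rho> \<in> rays"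
  shows "\<rho> 0 = w" "\<rho> n \<in> X" "i \<le> j \<Longrightarrow> d (\<rho> i) (\<rho> j) = j - i" "d w (\<rho> n) = n"
proof -
  show 1: "\<rho> 0 = w" using assms by (simp add: rays_def)
  show "\<rho> n \<in> X" using assms by (auto simp: rays_def geodesic_def)
  show 2: "i \<le> j \<Longrightarrow> d (\<rho> i) (\<rho> j) = j - i" for i j using assms by (auto simp: rays_def geodesic_def)
  show "d w (\<rho> n) = n" using 2[of 0 n] 1 by simp
qed

text \<open>The common vertex at distance \<open>n\<close> gives a path from \<open>\<rho> i\<close> to \<open>\<sigma> j\<close> of length \<open>(i - n) + (j - n)\<close>.\<close>
lemma gp_rays_agreeing:
  assumes "\<rho> \<in> rays" "\<sigma> \<in> rays" "\<rho> n = \<sigma> n" "n \<le> i" "n \<le> j"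
  shows "real n \<le> gp w (\<rho> i) (\<sigma> j)"
proof -
  note R = raysD[OF assms(1)] and S = raysD[OF assms(2)]
  have "d (\<rho> i) (\<sigma> j) \<le> d (\<rho> i) (\<rho> n) + d (\<sigma> n) (\<sigma> j)"
    using dist_triangle[of "\<rho> i" "\<rho> n" "\<sigma> j"] R(2) S(2) assms(3) by simp
  also have "d (\<rho> i) (\<rho> n) = i - n" using R(3)[OF assms(4)] dist_sym R(2) by simp
  also have "d (\<sigma> n) (\<sigma> j) = j - n" using S(3)[OF assms(5)] .
  finally have "real (d (\<rho> i) (\<sigma> j)) \<le> real i - n + (real j - n)"
    using assms(4,5) by linarith
  moreover have "d (\<rho> i) w = i" "d (\<sigma> j) w = j"
    using R(2,4) S(2,4) dist_sym base by simp_all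
  ultimately show ?thesis by (simp add: gromov_product_def)
qed

lemma near_rays_agreeing:
  assumes "\<rho> \<in> rays" "\<sigma> \<in> rays" "\<rho> n = \<sigma> n" "r \<le> real n"
  shows "near r \<rho> \<sigma>"
  unfolding near_def using gp_rays_agreeing[OF assms(1-3)] assms(4) by (meson order_trans)

lemma ray_to_infinity:
  assumes "\<rho> \<in> rays"
  shows "\<rho> \<in> sequences_to_infinity X rdist w"
proof -
  have "near r \<rho> \<rho>" for r
    using near_rays_agreeing[OF assms assms refl, of r "nat \<lceil>r\<rceil>"] of_nat_ceiling[of r] by simp
  then show ?thesis using raysD(2)[OF assms] by (auto simp: sequences_to_infinity_iff)
qed

lemma endpoint_in_boundary: "\<rho> \<in> rays \<Longrightarrow> endpoint \<rho> \<in> boundary_points X rdist w"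
  unfolding endpoint_def boundary_points_def by (intro quotientI ray_to_infinity)

lemma ray_in_endpoint: "\<rho> \<in> rays \<Longrightarrow> \<rho> \<in> endpoint \<rho>"
  unfolding endpoint_def by (intro equiv_class_self[OF equiv_boundary_equiv] ray_to_infinity)

lemma countable_space: "countable X"
proof -
  have "X = (\<Union>n. {x \<in> X. d w x \<le> n})" by auto
  moreover have "countable (\<Union>n. {x \<in> X. d w x \<le> n})"
    using finite_balls by (intro countable_UN) (auto intro: countable_finite)
  ultimately show ?thesis by simp
qed

definition decode :: "(nat \<Rightarrow> nat) \<Rightarrow> nat \<Rightarrow> 'a" where
  "decode a n = from_nat_into X (a n)"

text \<open>A ray is at distance \<open>n\<close> from the base point at time \<open>n\<close>, so its codes lie in a product of finite
  sets, which is compact.\<close>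
definition ball_codes :: "(nat \<Rightarrow> nat) set" where
  "ball_codes = {a. \<forall>n. a n \<in> to_nat_on X ` {x \<in> X. d w x \<le> n}}"

definition ray_codes :: "(nat \<Rightarrow> nat) set" where
  "ray_codes = ball_codes \<inter> {a. decode a \<in> rays}"

lemma decode_code: "range \<rho> \<subseteq> X \<Longrightarrow> decode (to_nat_on X \<circ> \<rho>) = \<rho>"
  unfolding decode_def comp_def
  by (intro ext from_nat_into_to_nat_on[OF countable_space]) (rule subsetD[OF _ rangeI])

lemma decode_cong: "a n = b n \<Longrightarrow> decode a n = decode b n"
  by (simp add: decode_def)

lemma compact_ball_codes: "compact ball_codes"
  unfolding ball_codes_def using finite_balls by (intro compact_finite_branching) auto

lemma compact_ray_codes: "compact ray_codes"
proof -
  have "open (- {a. decode a \<in> rays})"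
  proof (rule open_if_cylinders)
    fix a assume "a \<in> - {a. decode a \<in> rays}"
    then have "decode a 0 \<noteq> w \<or> (\<exists>n. \<not> geodesic (decode a) n)" by (simp add: rays_def)
    then obtain n where n: "decode a 0 \<noteq> w \<or> \<not> geodesic (decode a) n" by blast
    have "decode b \<notin> rays" if "\<forall>i\<le>n. b i = a i" for b
    proof -
      have "\<forall>i\<le>n. decode b i = decode a i" using that by (simp add: decode_def)
      then have "decode b 0 = decode a 0" "geodesic (decode b) n = geodesic (decode a) n"
        by (auto simp: geodesic_def)
      then show ?thesis using n by (auto simp: rays_def)
    qed
    then show "\<exists>n. \<forall>b. (\<forall>i\<le>n. b i = a i) \<longrightarrow> b \<in> - {a. decode a \<in> rays}" by blast
  qed
  then have "closed {a. decode a \<in> rays}" by (simp add: closed_def)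
  then show ?thesis unfolding ray_codes_def using compact_ball_codes by (intro compact_Int_closed)
qed

lemma continuous_endpoint:
  "continuous_map (top_of_set ray_codes) (boundary_top X rdist w) (endpoint \<circ> decode)"
  unfolding continuous_map_def topspace_boundary_top
proof (intro conjI allI impI)
  show "endpoint \<circ> decode \<in> topspace (top_of_set ray_codes) \<rightarrow> boundary_points X rdist w"
    using endpoint_in_boundary by (auto simp: ray_codes_def)
  fix U assume U: "openin (boundary_top X rdist w) U"
  let ?V = "{a. \<exists>n. \<forall>b\<in>ray_codes. (\<forall>i\<le>n. b i = a i) \<longrightarrow> endpoint (decode b) \<in> U}"
  have "open ?V"
  proof (rule open_if_cylinders)
    fix a assume "a \<in> ?V"
    then obtain n where n: "\<forall>b\<in>ray_codes. (\<forall>i\<le>n. b i = a i) \<longrightarrow> endpoint (decode b) \<in> U" by blast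
    then have "\<forall>c. (\<forall>i\<le>n. c i = a i) \<longrightarrow> c \<in> ?V" by (auto intro!: exI[of _ n])
    then show "\<exists>n. \<forall>c. (\<forall>i\<le>n. c i = a i) \<longrightarrow> c \<in> ?V" by blast
  qed
  moreover have "{a \<in> ray_codes. endpoint (decode a) \<in> U} = ray_codes \<inter> ?V"
  proof (intro equalityI subsetI)
    fix a assume "a \<in> {a \<in> ray_codes. endpoint (decode a) \<in> U}"
    then have a: "a \<in> ray_codes" "decode a \<in> rays" "endpoint (decode a) \<in> U"
      by (auto simp: ray_codes_def)
    obtain r where r: "boundary_nhd X rdist w (endpoint (decode a)) r \<subseteq> U"
      using U a(3) unfolding openin_boundary_top by blast
    have "endpoint (decode b) \<in> U" if "b \<in> ray_codes" "\<forall>i\<le>nat \<lceil>r\<rceil>. b i = a i" for b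
    proof -
      have b: "decode b \<in> rays" using that(1) by (simp add: ray_codes_def)
      have "decode a (nat \<lceil>r\<rceil>) = decode b (nat \<lceil>r\<rceil>)" using that(2) by (intro decode_cong) simp
      then have "near r (decode a) (decode b)"
        by (rule near_rays_agreeing[OF a(2) b]) (rule of_nat_ceiling)
      then show ?thesis
        using boundary_nhdI[OF endpoint_in_boundary[OF b] ray_in_endpoint[OF a(2)] ray_in_endpoint[OF b]] r
        by blast
    qed
    then show "a \<in> ray_codes \<inter> ?V" using a(1) by blast
  qed blast
  ultimately show "openin (top_of_set ray_codes) {x \<in> topspace (top_of_set ray_codes). (endpoint \<circ> decode) x \<in> U}"
    by (simp add: openin_open) blast
qed

text \<open>Geodesics from the base point to the terms of \<open>u\<close> subconverge to a ray \<open>\<rho>\<close>, by compactness. An initial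
  segment of \<open>\<rho>\<close> of length \<open>j\<close> lies on the geodesic to some late term \<open>u k\<close>, so the Gromov product of
  \<open>\<rho> j\<close> and \<open>u k\<close> is \<open>j\<close>, while that of \<open>u k\<close> and \<open>u i\<close> is large. Hence \<open>\<rho>\<close> is equivalent to \<open>u\<close>.\<close>
lemma ray_to_boundary_point:
  assumes u: "u \<in> sequences_to_infinity X rdist w"
  obtains a where "a \<in> ray_codes" "(u, decode a) \<in> boundary_equiv X rdist w"
proof -
  have uX: "u k \<in> X" for k using u by (auto simp: sequences_to_infinity_iff)
  have "\<exists>\<gamma>. geodesic \<gamma> (d w (u k)) \<and> \<gamma> 0 = w \<and> \<gamma> (d w (u k)) = u k" for k
    using geodesic_exists[OF base uX] by blast
  then obtain \<gamma> where \<gamma>: "\<And>k. geodesic (\<gamma> k) (d w (u k))" "\<And>k. \<gamma> k 0 = w" "\<And>k. \<gamma> k (d w (u k)) = u k"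
    by metis
  \<comment> \<open>Extended by its end point, so that all these finite geodesics are sequences of ball points.\<close>
  define \<sigma> where "\<sigma> k n = \<gamma> k (min n (d w (u k)))" for k n
  have \<sigma>X: "\<sigma> k n \<in> X" for k n unfolding \<sigma>_def by (intro geodesicD(1)[OF \<gamma>(1)]) simp
  have "d w (\<sigma> k n) \<le> n" for k n
    using geodesicD(2)[OF \<gamma>(1), of 0 "min n (d w (u k))" k] \<gamma>(2) unfolding \<sigma>_def by simp
  then have "\<forall>k. to_nat_on X \<circ> \<sigma> k \<in> ball_codes"
    using \<sigma>X unfolding ball_codes_def by auto
  then obtain a \<phi> where a: "a \<in> ball_codes" and \<phi>: "strict_mono (\<phi> :: nat \<Rightarrow> nat)"
    and lim: "((\<lambda>k. to_nat_on X \<circ> \<sigma> k) \<circ> \<phi>) \<longlonglongrightarrow> a"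
    using compact_imp_seq_compact[OF compact_ball_codes] by (elim seq_compactE)
  have agree: "\<forall>\<^sub>F k in sequentially. \<forall>i\<le>n. \<sigma> (\<phi> k) i = decode a i" for n
  proof -
    have "\<forall>\<^sub>F k in sequentially. ((\<lambda>k. to_nat_on X \<circ> \<sigma> k) \<circ> \<phi>) k \<in> {b. \<forall>i\<le>n. b i = a i}"
      using lim open_cylinder[of n a] by (rule topological_tendstoD) simp
    then show ?thesis
    proof (rule eventually_mono)
      fix k assume "((\<lambda>k. to_nat_on X \<circ> \<sigma> k) \<circ> \<phi>) k \<in> {b. \<forall>i\<le>n. b i = a i}"
      then have "decode (to_nat_on X \<circ> \<sigma> (\<phi> k)) i = decode a i" if "i \<le> n" for i
        using that by (intro decode_cong) simp
      then show "\<forall>i\<le>n. \<sigma> (\<phi> k) i = decode a i"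
        using decode_code[of "\<sigma> (\<phi> k)"] \<sigma>X by (simp add: image_subset_iff)
    qed
  qed
  have far: "\<forall>\<^sub>F k in sequentially. n \<le> d w (u (\<phi> k))" for n
  proof -
    have "near (real n) u u" using u by (simp add: sequences_to_infinity_iff)
    then obtain N where N: "\<And>i. N \<le> i \<Longrightarrow> real n \<le> gp w (u i) (u i)"
      unfolding near_def by blast
    have "n \<le> d w (u (\<phi> k))" if "N \<le> k" for k
      using N[of "\<phi> k"] gp_le_dist[OF base uX uX, of "\<phi> k" "\<phi> k"] seq_suble[OF \<phi>, of k] that by linarith
    then show ?thesis unfolding eventually_sequentially by blast
  qed
  have both: "\<exists>k\<ge>N. n \<le> d w (u (\<phi> k)) \<and> (\<forall>i\<le>n. \<gamma> (\<phi> k) i = decode a i)" for n N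
  proof -
    have "\<forall>\<^sub>F k in sequentially. N \<le> k \<and> n \<le> d w (u (\<phi> k)) \<and> (\<forall>i\<le>n. \<sigma> (\<phi> k) i = decode a i)"
      by (intro eventually_conj eventually_ge_at_top far agree)
    then obtain k where "N \<le> k" "n \<le> d w (u (\<phi> k))" "\<forall>i\<le>n. \<sigma> (\<phi> k) i = decode a i"
      using eventually_happens'[OF sequentially_bot] by blast
    then show ?thesis unfolding \<sigma>_def by (intro exI[of _ k]) auto
  qed
  have geo: "geodesic (decode a) n" for n
  proof -
    obtain k where k: "n \<le> d w (u (\<phi> k))" "\<forall>i\<le>n. \<gamma> (\<phi> k) i = decode a i" using both by blast
    show ?thesis using geodesicD[OF \<gamma>(1)[of "\<phi> k"]] k unfolding geodesic_def by (metis order_trans)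
  qed
  have ray: "decode a \<in> rays"
    using both[of 0 0] \<gamma>(2) geo unfolding rays_def by auto
  have "near r u (decode a)" for r
  proof -
    obtain s where s: "\<And>x y z. x \<in> X \<Longrightarrow> y \<in> X \<Longrightarrow> z \<in> X \<Longrightarrow> s \<le> gp w x y \<Longrightarrow> s \<le> gp w y z \<Longrightarrow> r \<le> gp w x z"
      using coarsely_ultrametric[of r] by blast
    have "near s u u" using u by (simp add: sequences_to_infinity_iff)
    then obtain N where N: "\<And>i j. N \<le> i \<Longrightarrow> N \<le> j \<Longrightarrow> s \<le> gp w (u i) (u j)"
      unfolding near_def by blast
    have "r \<le> gp w (u i) (decode a j)" if "N \<le> i" "nat \<lceil>s\<rceil> \<le> j" for i j
    proof -
      obtain k where k: "N \<le> k" "j \<le> d w (u (\<phi> k))" "\<gamma> (\<phi> k) j = decode a j" using both[of N j] by blast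
      have N': "s \<le> gp w (u i) (u (\<phi> k))" using N that(1) k(1) seq_suble[OF \<phi>, of k] by simp
      have "d (decode a j) (u (\<phi> k)) = d w (u (\<phi> k)) - j"
        using geodesicD(2)[OF \<gamma>(1), of j "d w (u (\<phi> k))" "\<phi> k"] \<gamma>(3) k(2,3) by simp
      then have "gp w (u (\<phi> k)) (decode a j) = real j"
        using k(2) raysD(2,4)[OF ray, of j] dist_sym base uX by (simp add: gromov_product_def of_nat_diff)
      moreover have "s \<le> real j" using that(2) by linarith
      ultimately show ?thesis using s[OF uX uX raysD(2)[OF ray] N'] by simp
    qed
    then show ?thesis unfolding near_def by (intro exI[of _ "max N (nat \<lceil>s\<rceil>)"]) simp
  qed
  then have "(u, decode a) \<in> boundary_equiv X rdist w"
    using u ray_to_infinity[OF ray] by (simp add: boundary_equiv_iff)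
  moreover have "a \<in> ray_codes" using a ray by (simp add: ray_codes_def)
  ultimately show thesis using that by blast
qed

lemma endpoint_surj: "(endpoint \<circ> decode) ` ray_codes = boundary_points X rdist w"
proof (intro equalityI subsetI)
  fix p assume p: "p \<in> boundary_points X rdist w"
  obtain u where u: "u \<in> p" using boundary_point_nonempty[OF p] .
  obtain a where "a \<in> ray_codes" "(u, decode a) \<in> boundary_equiv X rdist w"
    using ray_to_boundary_point[OF boundary_point_elems(1)[OF p u]] .
  moreover from this have "p = endpoint (decode a)"
    using boundary_point_elems(3)[OF p u] equiv_class_eq[OF equiv_boundary_equiv]
    unfolding endpoint_def by blast
  ultimately show "p \<in> (endpoint \<circ> decode) ` ray_codes" by auto
qed (auto simp: ray_codes_def intro: endpoint_in_boundary)

theorem boundary_monotone_quotient: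
  "\<exists>(\<Lambda> :: (real ^ 3) set) q. compact \<Lambda> \<and> quotient_map (top_of_set \<Lambda>) (boundary_top X rdist w) q \<and>
    (\<forall>p\<in>topspace (boundary_top X rdist w). connected {y \<in> \<Lambda>. q y = p})"
  by (rule monotone_quotient_of_compact_Baire_set[OF compact_ray_codes continuous_endpoint _ Hausdorff_boundary])
    (simp only: endpoint_surj topspace_boundary_top)

end

section \<open>Gromov products of bilipschitz geodesic metrics\<close>

text \<open>Two path metrics that are bilipschitz equivalent, of which only \<open>h\<close> is known to satisfy the four
  point condition.\<close>
locale bilipschitz_to_hyperbolic =
  H: discrete_geodesic_space X h + D: discrete_geodesic_space X d
  for X :: "'a set" and h d :: "'a \<Rightarrow> 'a \<Rightarrow> nat" +
  fixes L :: nat and \<delta> :: real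
  assumes L_pos: "0 < L" and \<delta>_nonneg: "0 \<le> \<delta>"
    and h_le: "x \<in> X \<Longrightarrow> y \<in> X \<Longrightarrow> h x y \<le> L * d x y"
    and d_le: "x \<in> X \<Longrightarrow> y \<in> X \<Longrightarrow> d x y \<le> L * h x y"
    and hyperbolic: "w \<in> X \<Longrightarrow> x \<in> X \<Longrightarrow> y \<in> X \<Longrightarrow> z \<in> X \<Longrightarrow>
      min (H.gp w x y) (H.gp w y z) - \<delta> \<le> H.gp w x z"
begin

text \<open>Halving the chain costs one \<open>\<delta>\<close> per level, so the loss is logarithmic in the number of steps. This is
  the exponential divergence of hyperbolic geometry: a path around a large ball is exponentially long.\<close>
lemma chain_gromov_product:
  assumes "p \<in> X" "\<And>i. i \<le> n \<Longrightarrow> z i \<in> X" "\<And>i. i < n \<Longrightarrow> r \<le> H.gp p (z i) (z (Suc i))"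
    and "0 < n" "n \<le> 2 ^ k"
  shows "r - real k * \<delta> \<le> H.gp p (z 0) (z n)"
  using assms(2-)
proof (induction k arbitrary: n z)
  case 0
  then have "n = 1" by simp
  then show ?case using "0.prems"(2)[of 0] by simp
next
  case (Suc k)
  show ?case
  proof (cases "n \<le> 2 ^ k")
    case True
    have "r - real k * \<delta> \<le> H.gp p (z 0) (z n)"
      using Suc.prems True by (intro Suc.IH) auto
    then show ?thesis using \<delta>_nonneg by (simp add: algebra_simps)
  next
    case False
    define m where "m = (2::nat) ^ k"
    have m: "0 < m" "m < n" "n - m \<le> 2 ^ k" using False Suc.prems(4) by (auto simp: m_def)
    have "r - real k * \<delta> \<le> H.gp p (z 0) (z m)"
      using Suc.prems m by (intro Suc.IH) (auto simp: m_def)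
    moreover have "r - real k * \<delta> \<le> H.gp p (z (m + 0)) (z (m + (n - m)))"
      using Suc.prems m by (intro Suc.IH[of "n - m" "\<lambda>i. z (m + i)"]) auto
    then have "r - real k * \<delta> \<le> H.gp p (z m) (z n)" using m by simp
    moreover have "min (H.gp p (z 0) (z m)) (H.gp p (z m) (z n)) - \<delta> \<le> H.gp p (z 0) (z n)"
      using m Suc.prems(1) \<open>p \<in> X\<close> by (intro hyperbolic) auto
    ultimately show ?thesis by (simp add: algebra_simps)
  qed
qed

lemma chain_gromov_product_far:
  assumes "p \<in> X" and \<gamma>: "D.geodesic \<gamma> n" and far: "\<And>i. i \<le> n \<Longrightarrow> M \<le> h p (\<gamma> i)"
    and "i \<le> n" "j \<le> n" "d (\<gamma> i) (\<gamma> j) \<le> 2 ^ k"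
  shows "real M - real L - real k * \<delta> \<le> H.gp p (\<gamma> i) (\<gamma> j)"
proof -
  note X = D.geodesicD(1)[OF \<gamma>]
  have ordered: "real M - real L - real k * \<delta> \<le> H.gp p (\<gamma> i) (\<gamma> j)"
    if ij: "i \<le> j" "j \<le> n" "d (\<gamma> i) (\<gamma> j) \<le> 2 ^ k" for i j
  proof (cases "i = j")
    case True
    have "h (\<gamma> j) p = h p (\<gamma> j)" "h (\<gamma> j) (\<gamma> j) = 0"
      using H.dist_sym H.dist_eq_0 X ij(2) \<open>p \<in> X\<close> by simp_all
    then have "real M \<le> H.gp p (\<gamma> i) (\<gamma> j)"
      using True far[OF ij(2)] by (simp add: gromov_product_def)
    then show ?thesis using \<delta>_nonneg by (smt (verit) of_nat_0_le_iff zero_le_mult_iff)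
  next
    case False
    have step: "real M - real L \<le> H.gp p (\<gamma> (i + t)) (\<gamma> (i + Suc t))" if "t < j - i" for t
    proof -
      have t: "i + t \<le> n" "i + Suc t \<le> n" using that ij by auto
      have "h (\<gamma> (i + t)) (\<gamma> (i + Suc t)) \<le> L"
        using h_le[OF X[OF t(1)] X[OF t(2)]] D.geodesicD(2)[OF \<gamma>, of "i + t" "i + Suc t"] t by simp
      moreover have "h (\<gamma> (i + t)) p = h p (\<gamma> (i + t))" "h (\<gamma> (i + Suc t)) p = h p (\<gamma> (i + Suc t))"
        using H.dist_sym X t \<open>p \<in> X\<close> by blast+
      ultimately show ?thesis
        using far[OF t(1)] far[OF t(2)] unfolding gromov_product_def by simp
    qed
    have "real M - real L - real k * \<delta> \<le> H.gp p (\<gamma> (i + 0)) (\<gamma> (i + (j - i)))"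
    proof (rule chain_gromov_product[where z = "\<lambda>t. \<gamma> (i + t)"])
      show "j - i \<le> 2 ^ k" using D.geodesicD(2)[OF \<gamma> ij(1,2)] ij(3) by simp
    qed (use False ij X step \<open>p \<in> X\<close> in auto)
    then show ?thesis using ij(1) by simp
  qed
  show ?thesis
  proof (cases "i \<le> j")
    case True
    then show ?thesis using ordered assms by blast
  next
    case False
    then show ?thesis
      using ordered[of j i] assms D.dist_sym[OF X X] H.gp_sym[OF X X] by simp
  qed
qed

text \<open>The bound by which the Morse lemma concludes: with \<open>k\<close> the rounded logarithm of \<open>6 * L * M\<close>, the
  assumption on \<open>M\<close> bounds a linear function by a logarithmic one.\<close>
lemma linear_le_log_bounded:
  obtains M0 where
    "\<And>M. (\<And>k. 6 * L * M \<le> 2 ^ k \<Longrightarrow> real M \<le> real L + (real k + 2) * \<delta>) \<Longrightarrow> M \<le> M0"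
proof -
  \<comment> \<open>\<open>\<delta> + 1\<close> instead of \<open>\<delta>\<close> makes the coefficient of the logarithm nonzero, as its asymptotic
    expansion requires.\<close>
  have "eventually (\<lambda>M::real. real L + (log 2 (6 * real L * M + 1) + 3) * (\<delta> + 1) < M) at_top"
    using L_pos \<delta>_nonneg by real_asymp
  then have "\<forall>\<^sub>F M in sequentially. real L + (log 2 (6 * real L * real M + 1) + 3) * (\<delta> + 1) < real M"
    using filterlim_real_sequentially by (rule eventually_compose_filterlim)
  then obtain M0 where M0: "\<And>M. M0 \<le> M \<Longrightarrow>
      real L + (log 2 (6 * real L * real M + 1) + 3) * (\<delta> + 1) < real M"
    unfolding eventually_sequentially by blast
  show thesis
  proof (rule that, rule ccontr)
    fix M assume *: "\<And>k. 6 * L * M \<le> 2 ^ k \<Longrightarrow> real M \<le> real L + (real k + 2) * \<delta>" and "\<not> M \<le> M0"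
    define b where "b = log 2 (6 * real L * real M + 1)"
    have "1 \<le> 6 * real L * real M + 1" by simp
    then have "0 \<le> b" unfolding b_def by (subst zero_le_log_cancel_iff) linarith+
    define k where "k = nat \<lceil>b\<rceil>"
    have "real (6 * L * M) \<le> 2 powr b"
      unfolding b_def by (simp add: powr_log_cancel add_nonneg_pos)
    also have "\<dots> \<le> 2 powr real k" unfolding k_def by (intro powr_mono of_nat_ceiling) simp
    also have "\<dots> = real (2 ^ k)" by (simp add: powr_realpow)
    finally have "6 * L * M \<le> 2 ^ k" by (simp only: of_nat_le_iff)
    then have "real M \<le> real L + (real k + 2) * \<delta>" by (rule *)
    also have "(real k + 2) * \<delta> \<le> (b + 3) * (\<delta> + 1)"
    proof (rule mult_mono)
      show "real k + 2 \<le> b + 3" using \<open>0 \<le> b\<close> unfolding k_def by linarith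
    qed (use \<open>0 \<le> b\<close> \<delta>_nonneg in auto)
    also have "real L + (b + 3) * (\<delta> + 1) < real M" using M0[of M] \<open>\<not> M \<le> M0\<close> unfolding b_def by simp
    finally show False by simp
  qed
qed

text \<open>Going from \<open>p\<close> towards \<open>e\<close> for a distance of \<open>2 * M\<close>, or up to \<open>e\<close> itself if that is nearer, one
  reaches a point \<open>q\<close> such that, seen from \<open>p\<close>, the point \<open>q\<close> and a point of \<open>\<gamma>\<close> close to it lie in
  the same direction.\<close>
lemma projected_point:
  assumes "p \<in> X" "e \<in> X" and far: "\<And>i. i \<le> n \<Longrightarrow> M \<le> h p (\<gamma> i)"
    and \<gamma>: "\<And>i. i \<le> n \<Longrightarrow> \<gamma> i \<in> X" "e \<in> \<gamma> ` {..n}"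
    and close: "\<And>q. q \<in> X \<Longrightarrow> h e q + h q p = h e p \<Longrightarrow> \<exists>i\<le>n. h q (\<gamma> i) \<le> M"
  obtains q i where "q \<in> X" "i \<le> n" "h e q + h q p = h e p" "h q p \<le> 2 * M" "h q (\<gamma> i) \<le> M"
    "real M \<le> H.gp p q (\<gamma> i)"
proof (cases "h e p \<le> 2 * M")
  case True
  obtain i where i: "i \<le> n" "e = \<gamma> i" using \<gamma>(2) by auto
  have "h e e = 0" "h e p = h p e" using H.dist_eq_0 H.dist_sym assms by auto
  moreover have "M \<le> h p e" using far i by simp
  ultimately show thesis
    using that[of e i] i True assms(1,2) by (simp add: gromov_product_def)
next
  case False
  have le: "h e p - 2 * M \<le> h e p" by simp
  obtain q where q: "q \<in> X" "h e q = h e p - 2 * M" "h q p = h e p - (h e p - 2 * M)"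
    using H.point_at_distance[OF \<open>e \<in> X\<close> \<open>p \<in> X\<close> le] .
  then have q': "h q p = 2 * M" "h e q + h q p = h e p" using False by auto
  obtain i where i: "i \<le> n" "h q (\<gamma> i) \<le> M" using close[OF q(1) q'(2)] by blast
  have "h (\<gamma> i) p = h p (\<gamma> i)" using H.dist_sym \<gamma>(1) i assms by auto
  then have "real M \<le> H.gp p q (\<gamma> i)"
    using q'(1) i(2) far[OF i(1)] by (simp add: gromov_product_def)
  then show thesis using that q(1) q' i by simp
qed

text \<open>Half of the Morse lemma. Let \<open>p\<close> be the point between \<open>x\<close> and \<open>y\<close> that is farthest from \<open>\<gamma>\<close>, at distance
  \<open>M\<close>. Leave \<open>p\<close> for a distance of at most \<open>2 * M\<close> in both directions and project to \<open>\<gamma>\<close>. The resulting points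
  \<open>\<gamma> i\<close> and \<open>\<gamma> j\<close> have distance at most \<open>6 * M\<close>, so the part of \<open>\<gamma>\<close> between them has at most
  \<open>6 * L * M\<close> steps, all of them outside the ball of radius \<open>M\<close> around \<open>p\<close>. Since \<open>p\<close> separates the two
  directions, the Gromov product of the ends at \<open>p\<close> vanishes, whereas \<open>chain_gromov_product\<close>
  bounds it from below by \<open>M\<close> minus a multiple of \<open>log M\<close>. So \<open>M\<close> is bounded.\<close>
lemma geodesic_close_to_other_geodesic:
  obtains R where "\<And>x y p \<gamma>. x \<in> X \<Longrightarrow> y \<in> X \<Longrightarrow> p \<in> X \<Longrightarrow> h x p + h p y = h x y \<Longrightarrow>
    D.geodesic \<gamma> (d x y) \<Longrightarrow> \<gamma> 0 = x \<Longrightarrow> \<gamma> (d x y) = y \<Longrightarrow> \<exists>i\<le>d x y. h p (\<gamma> i) \<le> R"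
proof -
  obtain M0 where M0:
    "\<And>M. (\<And>k. 6 * L * M \<le> 2 ^ k \<Longrightarrow> real M \<le> real L + (real k + 2) * \<delta>) \<Longrightarrow> M \<le> M0"
    using linear_le_log_bounded by blast
  show thesis
  proof (rule that)
    fix x y p0 \<gamma>
    assume x: "x \<in> X" and y: "y \<in> X" and p0: "p0 \<in> X" "h x p0 + h p0 y = h x y"
      and geo: "D.geodesic \<gamma> (d x y)" and ends: "\<gamma> 0 = x" "\<gamma> (d x y) = y"
    define n where "n = d x y"
    note geo = geo[folded n_def] and ends = ends[folded n_def]
    note \<gamma>X = D.geodesicD(1)[OF geo]
    define between where "between p \<longleftrightarrow> p \<in> X \<and> h x p + h p y = h x y" for p
    define f where "f p = Min ((\<lambda>i. h p (\<gamma> i)) ` {..n})" for p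
    have f_le: "f p \<le> h p (\<gamma> i)" if "i \<le> n" for p i
      unfolding f_def using that by (intro Min_le) auto
    have f_attained: "\<exists>i\<le>n. h p (\<gamma> i) = f p" for p
    proof -
      have "f p \<in> (\<lambda>i. h p (\<gamma> i)) ` {..n}" unfolding f_def by (intro Min_in) auto
      then show ?thesis by auto
    qed
    have "f p \<le> h x y" if "between p" for p
      using f_le[of n p] that ends unfolding between_def by simp
    then obtain p where p: "between p" and max: "\<And>q. between q \<Longrightarrow> f q \<le> f p"
      using ex_has_greatest_nat[of between p0 f "Suc (h x y)"] p0 unfolding between_def
      by (metis less_Suc_eq_le)
    define M where "M = f p"
    have pX: "p \<in> X" and pxy: "h x p + h p y = h x y" using p by (auto simp: between_def)
    have far: "M \<le> h p (\<gamma> i)" if "i \<le> n" for i using f_le[OF that] by (simp add: M_def)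
    have close: "\<exists>i\<le>n. h q (\<gamma> i) \<le> M" if "between q" for q
      using f_attained[of q] max[OF that] by (auto simp: M_def)
    have closex: "\<exists>i\<le>n. h q (\<gamma> i) \<le> M" if "q \<in> X" "h x q + h q p = h x p" for q
    proof (rule close, unfold between_def, intro conjI)
      show "h x q + h q y = h x y"
        using H.dist_triangle[OF that(1) pX y] H.dist_triangle[OF x that(1) y] that(2) pxy by linarith
    qed (rule that)
    have closey: "\<exists>i\<le>n. h q (\<gamma> i) \<le> M" if "q \<in> X" "h y q + h q p = h y p" for q
    proof (rule close, unfold between_def, intro conjI)
      have "h y q = h q y" "h q p = h p q" "h y p = h p y" using H.dist_sym that pX y by auto
      then show "h x q + h q y = h x y"
        using H.dist_triangle[OF x pX that(1)] H.dist_triangle[OF x that(1) y] that(2) pxy by linarith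
    qed (rule that)
    have "x \<in> \<gamma> ` {..n}" "y \<in> \<gamma> ` {..n}" using ends by force+
    obtain x' i where x': "x' \<in> X" "i \<le> n" "h x x' + h x' p = h x p" "h x' p \<le> 2 * M" "h x' (\<gamma> i) \<le> M"
      "real M \<le> H.gp p x' (\<gamma> i)"
      using projected_point[OF pX x far \<gamma>X \<open>x \<in> \<gamma> ` {..n}\<close> closex] by blast
    obtain y' j where y': "y' \<in> X" "j \<le> n" "h y y' + h y' p = h y p" "h y' p \<le> 2 * M" "h y' (\<gamma> j) \<le> M"
      "real M \<le> H.gp p y' (\<gamma> j)"
      using projected_point[OF pX y far \<gamma>X \<open>y \<in> \<gamma> ` {..n}\<close> closey] by blast
    note I = \<gamma>X[OF x'(2)] and J = \<gamma>X[OF y'(2)]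
    have sym: "h y y' = h y' y" "h y p = h p y" "h p y' = h y' p" "h (\<gamma> i) x' = h x' (\<gamma> i)"
      using H.dist_sym x' y' pX y I by blast+
    have "h x' p + h y' p = h x' y'"
      using H.dist_triangle[OF x'(1) pX y'(1)] H.dist_triangle[OF x x'(1) y]
        H.dist_triangle[OF x'(1) y'(1) y] x'(3) y'(3) sym pxy by linarith
    then have zero: "H.gp p x' y' = 0" by (simp add: gromov_product_def flip: of_nat_add)
    have "h (\<gamma> i) (\<gamma> j) \<le> h (\<gamma> i) x' + (h x' y' + h y' (\<gamma> j))"
      using H.dist_triangle[OF I x'(1) J] H.dist_triangle[OF x'(1) y'(1) J] by linarith
    also have "\<dots> \<le> 6 * M"
      using sym x'(4,5) y'(4,5) \<open>h x' p + h y' p = h x' y'\<close> by linarith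
    finally have "L * h (\<gamma> i) (\<gamma> j) \<le> L * (6 * M)" by (rule mult_le_mono2)
    with d_le[OF I J] have "d (\<gamma> i) (\<gamma> j) \<le> L * (6 * M)" by (rule order_trans)
    then have dij: "d (\<gamma> i) (\<gamma> j) \<le> 6 * L * M" by (simp add: mult.left_commute)
    have "real M \<le> real L + (real k + 2) * \<delta>" if k: "6 * L * M \<le> 2 ^ k" for k
    proof -
      have "real M - real L - real k * \<delta> \<le> H.gp p (\<gamma> i) (\<gamma> j)"
        using chain_gromov_product_far[OF pX geo far x'(2) y'(2)] dij k by simp
      moreover have "real M \<le> H.gp p (\<gamma> j) y'" using y'(6) H.gp_sym[OF J y'(1)] by simp
      moreover have "min (H.gp p x' (\<gamma> i)) (H.gp p (\<gamma> i) y') - \<delta> \<le> H.gp p x' y'"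
        "min (H.gp p (\<gamma> i) (\<gamma> j)) (H.gp p (\<gamma> j) y') - \<delta> \<le> H.gp p (\<gamma> i) y'"
        using hyperbolic pX x'(1) y'(1) I J by blast+
      moreover have "0 \<le> real k * \<delta>" "0 \<le> real L" using \<delta>_nonneg by simp_all
      moreover have "(real k + 2) * \<delta> = real k * \<delta> + 2 * \<delta>" by (simp add: algebra_simps)
      ultimately show ?thesis using zero x'(6) \<delta>_nonneg by linarith
    qed
    then have "M \<le> M0" by (rule M0)
    moreover have "f p0 \<le> M" using max[of p0] p0 unfolding M_def between_def by simp
    ultimately show "\<exists>i\<le>d x y. h p0 (\<gamma> i) \<le> M0" using f_attained[of p0] unfolding n_def by auto
  qed
qed

text \<open>In a hyperbolic space the Gromov product is about the distance to a geodesic; the nearly closest point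
  sits where the inscribed circle of the triangle touches the side, rounded to a vertex.\<close>
lemma point_near_base:
  assumes "w \<in> X" "x \<in> X" "y \<in> X"
  obtains p where "p \<in> X" "h x p + h p y = h x y" "real (h w p) \<le> H.gp w x y + 1 + 2 * \<delta>"
proof -
  define a where "a = H.gp x y w"
  have sym: "h y x = h x y" "h w x = h x w" "h y w = h w y" using H.dist_sym assms by auto
  have "0 \<le> a" using H.dist_triangle[of y x w] assms sym by (simp add: a_def gromov_product_def)
  have "a \<le> h x y" using H.gp_le_dist[of x y w] assms by (simp add: a_def)
  define k where "k = nat \<lfloor>a\<rfloor>"
  have k: "real k \<le> a" "a < real k + 1" using \<open>0 \<le> a\<close> unfolding k_def by linarith+
  then have "k \<le> h x y" using \<open>a \<le> h x y\<close> by linarith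
  obtain p where p: "p \<in> X" "h x p = k" "h p y = h x y - k"
    using H.point_at_distance[OF assms(2,3) \<open>k \<le> h x y\<close>] .
  have psym: "h p w = h w p" using H.dist_sym p(1) assms by auto
  have hpy: "real (h p y) = real (h x y) - real k" using p(3) \<open>k \<le> h x y\<close> by (simp add: of_nat_diff)
  have "min (H.gp w x p) (H.gp w p y) - \<delta> \<le> H.gp w x y"
    using hyperbolic assms p(1) by blast
  then have "H.gp w x p - \<delta> \<le> H.gp w x y \<or> H.gp w p y - \<delta> \<le> H.gp w x y"
    by (simp add: min_def split: if_splits)
  then have "real (h w p) \<le> H.gp w x y + 1 + 2 * \<delta>"
    using k hpy unfolding a_def gromov_product_def sym psym p(2) by (elim disjE; simp add: field_simps)
  with p \<open>k \<le> h x y\<close> that show thesis by simp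
qed

text \<open>The \<open>h\<close>-geodesic from \<open>x\<close> to \<open>y\<close> comes as close to \<open>w\<close> as the product for \<open>h\<close> says; by the Morse lemma
  so does the \<open>d\<close>-geodesic, and the product for \<open>d\<close> is at most the distance from \<open>w\<close> to that one.\<close>
lemma gromov_product_upper:
  obtains C where "\<And>w x y. w \<in> X \<Longrightarrow> x \<in> X \<Longrightarrow> y \<in> X \<Longrightarrow> D.gp w x y \<le> real L * H.gp w x y + C"
proof -
  obtain R where R: "\<And>x y p \<gamma>. x \<in> X \<Longrightarrow> y \<in> X \<Longrightarrow> p \<in> X \<Longrightarrow> h x p + h p y = h x y \<Longrightarrow>
    D.geodesic \<gamma> (d x y) \<Longrightarrow> \<gamma> 0 = x \<Longrightarrow> \<gamma> (d x y) = y \<Longrightarrow> \<exists>i\<le>d x y. h p (\<gamma> i) \<le> R"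
    using geodesic_close_to_other_geodesic by blast
  show thesis
  proof (rule that)
    fix w x y assume X: "w \<in> X" "x \<in> X" "y \<in> X"
    obtain p where p: "p \<in> X" "h x p + h p y = h x y" "real (h w p) \<le> H.gp w x y + 1 + 2 * \<delta>"
      using point_near_base[OF X] .
    obtain \<gamma> where \<gamma>: "D.geodesic \<gamma> (d x y)" "\<gamma> 0 = x" "\<gamma> (d x y) = y"
      using D.geodesic_exists[OF X(2,3)] .
    obtain i where i: "i \<le> d x y" "h p (\<gamma> i) \<le> R" using R[OF X(2,3) p(1,2) \<gamma>] by blast
    have q: "\<gamma> i \<in> X" using D.geodesicD(1)[OF \<gamma>(1) i(1)] .
    have "real (d x y) = real (d x (\<gamma> i)) + real (d (\<gamma> i) y)"
      using D.geodesicD(2)[OF \<gamma>(1), of 0 i] D.geodesicD(2)[OF \<gamma>(1), of i "d x y"] \<gamma>(2,3) i(1) by simp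
    moreover have "real (d x w) \<le> real (d x (\<gamma> i)) + real (d w (\<gamma> i))"
      "real (d y w) \<le> real (d (\<gamma> i) y) + real (d w (\<gamma> i))"
      using D.dist_triangle[OF X(2) q X(1)] D.dist_triangle[OF X(3) q X(1)] D.dist_sym X q
      by (simp_all flip: of_nat_add)
    ultimately have "D.gp w x y \<le> d w (\<gamma> i)"
      unfolding gromov_product_def by (simp add: field_simps)
    also have "\<dots> \<le> real L * real (h w (\<gamma> i))"
      using d_le[OF X(1) q] by (simp flip: of_nat_mult)
    also have "\<dots> \<le> real L * (H.gp w x y + 1 + 2 * \<delta> + R)"
      using H.dist_triangle[OF X(1) p(1) q] p(3) i(2) by (intro mult_left_mono) linarith+
    also have "\<dots> = real L * H.gp w x y + real L * (1 + 2 * \<delta> + R)" by (simp add: algebra_simps)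
    finally show "D.gp w x y \<le> real L * H.gp w x y + real L * (1 + 2 * \<delta> + R)" .
  qed
qed

text \<open>Up to time \<open>m\<close>, about the product for \<open>h\<close>, the \<open>h\<close>-geodesics from \<open>w\<close> to \<open>x\<close> and to \<open>y\<close> stay close
  together. By the Morse lemma the \<open>d\<close>-geodesics pass near their points at time \<open>m\<close>, hence near each
  other, at points \<open>q\<close> and \<open>q'\<close> that are far from \<open>w\<close>. The shortcut from \<open>q\<close> to \<open>q'\<close> bounds \<open>d x y\<close>.\<close>
lemma gromov_product_lower:
  obtains C where "\<And>w x y. w \<in> X \<Longrightarrow> x \<in> X \<Longrightarrow> y \<in> X \<Longrightarrow> H.gp w x y \<le> real L * D.gp w x y + C"
proof -
  obtain R where R: "\<And>x y p \<gamma>. x \<in> X \<Longrightarrow> y \<in> X \<Longrightarrow> p \<in> X \<Longrightarrow> h x p + h p y = h x y \<Longrightarrow>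
    D.geodesic \<gamma> (d x y) \<Longrightarrow> \<gamma> 0 = x \<Longrightarrow> \<gamma> (d x y) = y \<Longrightarrow> \<exists>i\<le>d x y. h p (\<gamma> i) \<le> R"
    using geodesic_close_to_other_geodesic by blast
  have shadow: "\<exists>q\<in>X. d w x = d w q + d q x \<and> h p q \<le> R"
    if wxp: "w \<in> X" "x \<in> X" "p \<in> X" "h w p + h p x = h w x" for w x p
  proof -
    obtain \<gamma> where \<gamma>: "D.geodesic \<gamma> (d w x)" "\<gamma> 0 = w" "\<gamma> (d w x) = x"
      using D.geodesic_exists[OF wxp(1,2)] .
    obtain i where i: "i \<le> d w x" "h p (\<gamma> i) \<le> R" using R[OF wxp \<gamma>] by blast
    moreover have "d w (\<gamma> i) = i" "d (\<gamma> i) x = d w x - i"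
      using D.geodesicD(2)[OF \<gamma>(1), of 0 i] D.geodesicD(2)[OF \<gamma>(1), of i "d w x"] \<gamma>(2,3) i(1) by simp_all
    ultimately show ?thesis using D.geodesicD(1)[OF \<gamma>(1) i(1)] by (intro bexI[of _ "\<gamma> i"]) auto
  qed
  define Q where "Q = real L * (2 * real R + 4 * \<delta>)"
  define C where "C = 1 + real R + real L * Q / 2"
  show thesis
  proof (rule that)
    fix w x y assume X: "w \<in> X" "x \<in> X" "y \<in> X"
    have sym: "h x w = h w x" "h y w = h w y" "d x w = d w x" "d y w = d w y"
      using H.dist_sym D.dist_sym X by auto
    have "0 \<le> H.gp w x y" using H.dist_triangle[OF X(2,1,3)] sym by (simp add: gromov_product_def)
    define m where "m = nat \<lfloor>H.gp w x y\<rfloor>"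
    have m: "real m \<le> H.gp w x y" "H.gp w x y < real m + 1"
      using \<open>0 \<le> H.gp w x y\<close> unfolding m_def by linarith+
    have "m \<le> h w x" "m \<le> h w y"
      using m(1) H.gp_le_dist[OF X] H.gp_le_dist[OF X(1,3,2)] H.gp_sym[OF X(2,3), of w] by linarith+
    obtain p where p: "p \<in> X" "h w p = m" "h p x = h w x - m"
      using H.point_at_distance[OF X(1,2) \<open>m \<le> h w x\<close>] .
    obtain p' where p': "p' \<in> X" "h w p' = m" "h p' y = h w y - m"
      using H.point_at_distance[OF X(1,3) \<open>m \<le> h w y\<close>] .
    have psym: "h p w = h w p" "h p' w = h w p'" "h y p' = h p' y"
      using H.dist_sym X p(1) p'(1) by auto
    have "H.gp w p x = real m" "H.gp w y p' = real m"
      using p p' psym sym \<open>m \<le> h w x\<close> \<open>m \<le> h w y\<close> by (simp_all add: gromov_product_def of_nat_diff)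
    moreover have "min (H.gp w p x) (H.gp w x p') - \<delta> \<le> H.gp w p p'"
      "min (H.gp w x y) (H.gp w y p') - \<delta> \<le> H.gp w x p'"
      using hyperbolic X p(1) p'(1) by blast+
    ultimately have "real m - 2 * \<delta> \<le> H.gp w p p'"
      using m(1) \<delta>_nonneg by (simp add: min_def split: if_splits)
    then have pp': "real (h p p') \<le> 4 * \<delta>" using p(2) p'(2) psym by (simp add: gromov_product_def)
    obtain q where q: "q \<in> X" "d w x = d w q + d q x" "h p q \<le> R"
      using shadow[OF X(1,2) p(1)] p \<open>m \<le> h w x\<close> by auto
    obtain q' where q': "q' \<in> X" "d w y = d w q' + d q' y" "h p' q' \<le> R"
      using shadow[OF X(1,3) p'(1)] p' \<open>m \<le> h w y\<close> by auto
    have qsym: "h q p = h p q" "d x q = d q x" "h q' p' = h p' q'" using H.dist_sym D.dist_sym X q(1) q'(1) p(1) p'(1) by auto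
    have "real (h q q') \<le> 2 * real R + 4 * \<delta>"
      using H.dist_triangle[OF q(1) p(1) q'(1)] H.dist_triangle[OF p(1) p'(1) q'(1)] q(3) q'(3) pp' qsym
      by linarith
    then have "real L * real (h q q') \<le> Q" unfolding Q_def by (intro mult_left_mono) simp_all
    moreover have "real (d q q') \<le> real L * real (h q q')"
      using d_le[OF q(1) q'(1)] by (simp flip: of_nat_mult)
    ultimately have qq': "real (d q q') \<le> Q" by linarith
    have "d x y \<le> d q x + d q q' + d q' y"
      using D.dist_triangle[OF X(2) q(1) X(3)] D.dist_triangle[OF q(1) q'(1) X(3)] qsym by linarith
    then have "real (d w q) + real (d w q') - real (d q q') \<le> 2 * D.gp w x y"
      using q(2) q'(2) sym unfolding gromov_product_def by simp
    then have "real (d w q) + real (d w q') \<le> 2 * D.gp w x y + Q"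
      using qq' by linarith
    then have "real L * (real (d w q) + real (d w q')) \<le> real L * (2 * D.gp w x y + Q)"
      by (intro mult_left_mono) simp_all
    moreover have "real m - R \<le> real L * real (d w q)" "real m - R \<le> real L * real (d w q')"
    proof -
      have "m \<le> h w q + R" using H.dist_triangle[OF X(1) q(1) p(1)] q(3) p(2) qsym by linarith
      moreover have "h w q \<le> L * d w q" by (rule h_le[OF X(1) q(1)])
      ultimately have "m \<le> L * d w q + R" by linarith
      then have "real m \<le> real (L * d w q + R)" by (simp only: of_nat_le_iff)
      then show "real m - R \<le> real L * real (d w q)" by simp
      have "m \<le> h w q' + R" using H.dist_triangle[OF X(1) q'(1) p'(1)] q'(3) p'(2) qsym by linarith
      moreover have "h w q' \<le> L * d w q'" by (rule h_le[OF X(1) q'(1)])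
      ultimately have "m \<le> L * d w q' + R" by linarith
      then have "real m \<le> real (L * d w q' + R)" by (simp only: of_nat_le_iff)
      then show "real m - R \<le> real L * real (d w q')" by simp
    qed
    ultimately have "2 * (real m - R) \<le> 2 * (real L * D.gp w x y) + real L * Q"
      by (simp add: distrib_left)
    then show "H.gp w x y \<le> real L * D.gp w x y + C" using m(2) unfolding C_def by (simp add: field_simps)
  qed
qed

theorem coarsely_ultrametric_transfer:
  "\<exists>s. \<forall>w\<in>X. \<forall>x\<in>X. \<forall>y\<in>X. \<forall>z\<in>X. s \<le> D.gp w x y \<and> s \<le> D.gp w y z \<longrightarrow> r \<le> D.gp w x z"
proof -
  obtain C where C: "\<And>w x y. w \<in> X \<Longrightarrow> x \<in> X \<Longrightarrow> y \<in> X \<Longrightarrow> D.gp w x y \<le> real L * H.gp w x y + C"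
    using gromov_product_upper by blast
  obtain C' where C': "\<And>w x y. w \<in> X \<Longrightarrow> x \<in> X \<Longrightarrow> y \<in> X \<Longrightarrow> H.gp w x y \<le> real L * D.gp w x y + C'"
    using gromov_product_lower by blast
  define t where "t = real L * r + \<delta> + C'"
  show ?thesis
  proof (intro exI ballI impI)
    fix w x y z assume X: "w \<in> X" "x \<in> X" "y \<in> X" "z \<in> X"
      and s: "real L * t + C \<le> D.gp w x y \<and> real L * t + C \<le> D.gp w y z"
    have "real L * t \<le> real L * H.gp w x y" "real L * t \<le> real L * H.gp w y z"
      using C[OF X(1-3)] C[OF X(1,3,4)] s by linarith+
    then have "t \<le> H.gp w x y" "t \<le> H.gp w y z" using L_pos by simp_all
    then have "t - \<delta> \<le> H.gp w x z" using hyperbolic[OF X] by linarith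
    then have "real L * r \<le> real L * D.gp w x z" using C'[OF X(1,2,4)] unfolding t_def by linarith
    then show "r \<le> D.gp w x z" using L_pos by simp
  qed
qed

end

section \<open>Word metrics and hyperbolic groups\<close>

definition word_metric :: "('g, 'm) monoid_scheme \<Rightarrow> 'g set \<Rightarrow> 'g \<Rightarrow> 'g \<Rightarrow> nat" where
  "word_metric G S g h = word_norm G S (inv\<^bsub>G\<^esub> g \<otimes>\<^bsub>G\<^esub> h)"

lemma word_dist_eq: "word_dist G S = (\<lambda>g h. real (word_metric G S g h))"
  by (simp add: fun_eq_iff word_dist_def word_metric_def)

locale generated_group = group G for G :: "('g, 'm) monoid_scheme" (structure) +
  fixes S :: "'g set"
  assumes fin_gen: "finite_generating_set G S"
begin

definition is_word :: "'g list \<Rightarrow> 'g \<Rightarrow> bool" where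
  "is_word xs g \<longleftrightarrow> set xs \<subseteq> S \<union> m_inv G ` S \<and> foldr (\<otimes>) xs \<one> = g"

lemma letters_closed: "S \<union> m_inv G ` S \<subseteq> carrier G"
  using fin_gen by (auto simp: finite_generating_set_def)

lemma inv_letter: "x \<in> S \<union> m_inv G ` S \<Longrightarrow> inv x \<in> S \<union> m_inv G ` S"
  using fin_gen by (force simp: finite_generating_set_def)

lemma is_word_Nil: "is_word [] g \<longleftrightarrow> g = \<one>"
  by (auto simp: is_word_def)

lemma is_word_closed: "is_word xs g \<Longrightarrow> g \<in> carrier G"
proof (induction xs arbitrary: g)
  case (Cons x xs)
  then have "x \<in> carrier G" "foldr (\<otimes>) xs \<one> \<in> carrier G"
    using letters_closed by (auto simp: is_word_def)
  then show ?case using Cons.prems by (auto simp: is_word_def)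
qed (simp add: is_word_def)

lemma is_word_ConsD:
  assumes "is_word (x # xs) g"
  obtains g' where "is_word [x] x" "is_word xs g'" "g = x \<otimes> g'" "x \<in> carrier G" "g' \<in> carrier G"
proof -
  have x: "x \<in> carrier G" using assms letters_closed by (auto simp: is_word_def)
  have "is_word xs (foldr (\<otimes>) xs \<one>)" using assms by (simp add: is_word_def)
  then show thesis using that[of "foldr (\<otimes>) xs \<one>"] x is_word_closed assms by (simp add: is_word_def)
qed

lemma is_word_append: "is_word xs g \<Longrightarrow> is_word ys h \<Longrightarrow> is_word (xs @ ys) (g \<otimes> h)"
proof (induction xs arbitrary: g)
  case Nil
  then show ?case using is_word_closed[OF Nil(2)] by (simp add: is_word_Nil)
next
  case (Cons x xs)
  obtain g' where g': "is_word [x] x" "is_word xs g'" "g = x \<otimes> g'" "x \<in> carrier G" "g' \<in> carrier G"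
    using is_word_ConsD[OF Cons.prems(1)] .
  have "is_word (xs @ ys) (g' \<otimes> h)" using Cons.IH[OF g'(2) Cons.prems(2)] .
  then show ?case
    using g' m_assoc[OF g'(4,5) is_word_closed[OF Cons.prems(2)]] by (auto simp: is_word_def)
qed

lemma is_word_inv: "is_word xs g \<Longrightarrow> \<exists>ys. length ys = length xs \<and> is_word ys (inv g)"
proof (induction xs arbitrary: g)
  case Nil
  then show ?case by (simp add: is_word_Nil)
next
  case (Cons x xs)
  obtain g' where g': "is_word [x] x" "is_word xs g'" "g = x \<otimes> g'" "x \<in> carrier G" "g' \<in> carrier G"
    using is_word_ConsD[OF Cons.prems] .
  obtain ys where ys: "length ys = length xs" "is_word ys (inv g')" using Cons.IH[OF g'(2)] by blast
  have "is_word [inv x] (inv x)" using g'(1,4) inv_letter by (simp add: is_word_def)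
  then have "is_word (ys @ [inv x]) (inv g' \<otimes> inv x)" using is_word_append ys(2) by blast
  then show ?case using ys(1) g' by (intro exI[of _ "ys @ [inv x]"]) (simp add: inv_mult_group)
qed

lemma word_exists:
  assumes "g \<in> carrier G"
  shows "\<exists>xs. is_word xs g"
proof -
  have "g \<in> generate G S" using assms fin_gen by (simp add: finite_generating_set_def)
  then show ?thesis
  proof (induction rule: generate.induct)
    case one
    then show ?case using is_word_Nil by blast
  next
    case (incl h)
    then have "is_word [h] h" using letters_closed by (auto simp: is_word_def)
    then show ?case by blast
  next
    case (inv h)
    then have "is_word [inv h] (inv h)" using letters_closed by (auto simp: is_word_def)
    then show ?case by blast
  next
    case (eng h1 h2)
    then show ?case using is_word_append by blast
  qed
qed

abbreviation wnorm where "wnorm \<equiv> word_norm G S"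

lemma norm_eq: "wnorm g = (LEAST n. \<exists>xs. length xs = n \<and> is_word xs g)"
  by (simp add: word_norm_def is_word_def)

lemma norm_le: "is_word xs g \<Longrightarrow> wnorm g \<le> length xs"
  unfolding norm_eq by (rule Least_le) blast

lemma shortest_word:
  assumes "g \<in> carrier G"
  obtains xs where "length xs = wnorm g" "is_word xs g"
proof -
  have "\<exists>n xs. length xs = n \<and> is_word xs g" using word_exists[OF assms] by blast
  from LeastI_ex[OF this] show thesis using that unfolding norm_eq by blast
qed

lemma norm_eq_0:
  assumes "g \<in> carrier G"
  shows "wnorm g = 0 \<longleftrightarrow> g = \<one>"
proof
  obtain xs where xs: "length xs = wnorm g" "is_word xs g" using shortest_word[OF assms] .
  assume "wnorm g = 0"
  then show "g = \<one>" using xs by (simp add: is_word_Nil)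
next
  assume "g = \<one>"
  then show "wnorm g = 0" using norm_le[of "[]" g] by (simp add: is_word_Nil)
qed

lemma norm_mult_le:
  assumes "g \<in> carrier G" "h \<in> carrier G"
  shows "wnorm (g \<otimes> h) \<le> wnorm g + wnorm h"
proof -
  obtain xs where xs: "length xs = wnorm g" "is_word xs g" using shortest_word[OF assms(1)] .
  obtain ys where ys: "length ys = wnorm h" "is_word ys h" using shortest_word[OF assms(2)] .
  show ?thesis using norm_le[OF is_word_append[OF xs(2) ys(2)]] xs(1) ys(1) by simp
qed

lemma norm_inv:
  assumes "g \<in> carrier G"
  shows "wnorm (inv g) = wnorm g"
proof -
  have le: "wnorm (inv h) \<le> wnorm h" if h: "h \<in> carrier G" for h
  proof -
    obtain xs where xs: "length xs = wnorm h" "is_word xs h" using shortest_word[OF h] .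
    obtain ys where "length ys = length xs" "is_word ys (inv h)" using is_word_inv[OF xs(2)] by blast
    then show ?thesis using norm_le[of ys] xs(1) by simp
  qed
  show ?thesis using le[of g] le[of "inv g"] assms by simp
qed

lemma norm_first_letter:
  assumes "g \<in> carrier G" "wnorm g = Suc n"
  obtains x g' where "x \<in> carrier G" "g' \<in> carrier G" "g = x \<otimes> g'" "wnorm x = 1" "wnorm g' = n"
proof -
  obtain xs where "length xs = Suc n" "is_word xs g" using shortest_word[OF assms(1)] unfolding assms(2) .
  then obtain x ys where ys: "length ys = n" "is_word (x # ys) g" by (cases xs) auto
  obtain g' where g': "is_word [x] x" "is_word ys g'" "g = x \<otimes> g'" "x \<in> carrier G" "g' \<in> carrier G"
    using is_word_ConsD[OF ys(2)] .
  have "wnorm x = 1 \<and> wnorm g' = n"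
    using norm_le[OF g'(1)] norm_le[OF g'(2)] norm_mult_le[OF g'(4,5)] ys(1) assms(2)
    unfolding g'(3) by simp
  then show thesis using that g' by blast
qed

lemma word_metric_geodesic: "discrete_geodesic_space (carrier G) (word_metric G S)"
proof
  fix x y assume X: "x \<in> carrier G" "y \<in> carrier G"
  show "word_metric G S x y = 0 \<longleftrightarrow> x = y"
  proof -
    have "\<one> = inv x \<otimes> y \<longleftrightarrow> y = x \<otimes> \<one>" using X by (intro inv_solve_left) auto
    then have "inv x \<otimes> y = \<one> \<longleftrightarrow> x = y" using X by (metis r_one)
    then show ?thesis unfolding word_metric_def using norm_eq_0[of "inv x \<otimes> y"] X by simp
  qed
  show "word_metric G S x y = word_metric G S y x"
    using X norm_inv[of "inv x \<otimes> y"] by (simp add: word_metric_def inv_mult_group)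
  {
    fix z assume z: "z \<in> carrier G"
    have "y \<otimes> (inv y \<otimes> z) = z" using X z by (simp flip: m_assoc)
    then have "inv x \<otimes> z = (inv x \<otimes> y) \<otimes> (inv y \<otimes> z)" using X z by (simp add: m_assoc)
    then show "word_metric G S x z \<le> word_metric G S x y + word_metric G S y z"
      using X z norm_mult_le[of "inv x \<otimes> y" "inv y \<otimes> z"] by (simp add: word_metric_def)
  }
  {
    fix n assume "word_metric G S x y = Suc n"
    then obtain t g where t: "t \<in> carrier G" "g \<in> carrier G" "inv x \<otimes> y = t \<otimes> g" "wnorm t = 1" "wnorm g = n"
      using norm_first_letter[of "inv x \<otimes> y" n] X by (auto simp: word_metric_def)
    have "inv x \<otimes> (x \<otimes> t) = t" using X t(1) by (simp flip: m_assoc)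
    moreover have "inv (x \<otimes> t) \<otimes> y = inv t \<otimes> (inv x \<otimes> y)"
      using X t(1) by (simp add: inv_mult_group m_assoc)
    moreover have "inv t \<otimes> (t \<otimes> g) = g" using t(1,2) by (simp flip: m_assoc)
    ultimately show "\<exists>z\<in>carrier G. word_metric G S x z = 1 \<and> word_metric G S z y = n"
      using X t(1,3-5) by (intro bexI[of _ "x \<otimes> t"]) (simp_all add: word_metric_def)
  }
qed

lemma finite_norm_balls: "finite {g \<in> carrier G. wnorm g \<le> n}"
proof (rule finite_subset)
  have "finite (S \<union> m_inv G ` S)" using fin_gen by (simp add: finite_generating_set_def)
  then show "finite ((\<lambda>xs. foldr (\<otimes>) xs \<one>) ` {xs. set xs \<subseteq> S \<union> m_inv G ` S \<and> length xs \<le> n})"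
    by (intro finite_imageI finite_lists_length_le)
  show "{g \<in> carrier G. wnorm g \<le> n} \<subseteq> (\<lambda>xs. foldr (\<otimes>) xs \<one>) ` {xs. set xs \<subseteq> S \<union> m_inv G ` S \<and> length xs \<le> n}"
  proof
    fix g assume "g \<in> {g \<in> carrier G. wnorm g \<le> n}"
    moreover from this obtain xs where "length xs = wnorm g" "is_word xs g" using shortest_word by auto
    ultimately show "g \<in> (\<lambda>xs. foldr (\<otimes>) xs \<one>) ` {xs. set xs \<subseteq> S \<union> m_inv G ` S \<and> length xs \<le> n}"
      by (auto simp: is_word_def)
  qed
qed

end

text \<open>Rewriting every letter of a shortest word in the other generators multiplies its length by at most a
  constant.\<close>
lemma word_norm_lipschitz:
  assumes "group G" "finite_generating_set G S" "finite_generating_set G T"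
  obtains L where "0 < L" "\<And>g. g \<in> carrier G \<Longrightarrow> word_norm G S g \<le> L * word_norm G T g"
proof -
  interpret S: generated_group G S
    using assms(1,2) by (simp add: generated_group_def generated_group_axioms_def)
  interpret T: generated_group G T
    using assms(1,3) by (simp add: generated_group_def generated_group_axioms_def)
  define L where "L = Suc (\<Sum>t\<in>T \<union> m_inv G ` T. word_norm G S t)"
  have fin: "finite (T \<union> m_inv G ` T)" using assms(3) by (simp add: finite_generating_set_def)
  have letter: "word_norm G S t \<le> L" if "t \<in> T \<union> m_inv G ` T" for t
    unfolding L_def using member_le_sum[OF that _ fin, of "word_norm G S"] by simp
  have word: "word_norm G S g \<le> L * length xs" if "T.is_word xs g" for xs g
    using that
  proof (induction xs arbitrary: g)
    case Nil
    then show ?case using S.norm_eq_0[of g] by (simp add: T.is_word_Nil)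
  next
    case (Cons x xs)
    obtain g' where g': "T.is_word [x] x" "T.is_word xs g'" "g = x \<otimes>\<^bsub>G\<^esub> g'" "x \<in> carrier G" "g' \<in> carrier G"
      using T.is_word_ConsD[OF Cons.prems] .
    have "word_norm G S x \<le> L" using letter g'(1) by (simp add: T.is_word_def)
    then show ?case using S.norm_mult_le[OF g'(4,5)] Cons.IH[OF g'(2)] g'(3) by simp
  qed
  show thesis
  proof (rule that)
    show "0 < L" by (simp add: L_def)
    fix g assume "g \<in> carrier G"
    then obtain xs where xs: "length xs = word_norm G T g" "T.is_word xs g" using T.shortest_word by blast
    show "word_norm G S g \<le> L * word_norm G T g" using word[OF xs(2)] unfolding xs(1) .
  qed
qed

lemma hyperbolic_group_coarsely_ultrametric:
  assumes "hyperbolic_group G" "finite_generating_set G S"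
  shows "\<exists>s. \<forall>w\<in>carrier G. \<forall>x\<in>carrier G. \<forall>y\<in>carrier G. \<forall>z\<in>carrier G.
    s \<le> gromov_product (word_dist G S) w x y \<and> s \<le> gromov_product (word_dist G S) w y z \<longrightarrow>
    r \<le> gromov_product (word_dist G S) w x z"
proof -
  obtain T where "group G" and T: "finite_generating_set G T"
    and "gromov_hyperbolic (carrier G) (word_dist G T)"
    using assms(1) unfolding hyperbolic_group_def by blast
  then obtain \<delta> where \<delta>: "\<And>w x y z. \<lbrakk>w \<in> carrier G; x \<in> carrier G; y \<in> carrier G; z \<in> carrier G\<rbrakk> \<Longrightarrow>
      min (gromov_product (word_dist G T) w x y) (gromov_product (word_dist G T) w y z) - \<delta>
        \<le> gromov_product (word_dist G T) w x z"
    unfolding gromov_hyperbolic_def by blast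
  interpret group G by fact
  obtain L where L: "0 < L" "\<And>g. g \<in> carrier G \<Longrightarrow> word_norm G S g \<le> L * word_norm G T g"
    using word_norm_lipschitz[OF \<open>group G\<close> assms(2) T] by blast
  obtain L' where L': "0 < L'" "\<And>g. g \<in> carrier G \<Longrightarrow> word_norm G T g \<le> L' * word_norm G S g"
    using word_norm_lipschitz[OF \<open>group G\<close> T assms(2)] by blast
  interpret bilipschitz_to_hyperbolic "carrier G" "word_metric G T" "word_metric G S" "max L L'" "max 0 \<delta>"
  proof (intro bilipschitz_to_hyperbolic.intro bilipschitz_to_hyperbolic_axioms.intro)
    show "discrete_geodesic_space (carrier G) (word_metric G T)" "discrete_geodesic_space (carrier G) (word_metric G S)"
      using generated_group.word_metric_geodesic \<open>group G\<close> assms(2) T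
      by (auto simp: generated_group_def generated_group_axioms_def)
    fix x y assume "x \<in> carrier G" "y \<in> carrier G"
    then have xy: "inv\<^bsub>G\<^esub> x \<otimes>\<^bsub>G\<^esub> y \<in> carrier G" by simp
    show "word_metric G T x y \<le> max L L' * word_metric G S x y"
      unfolding word_metric_def by (rule order_trans[OF L'(2)[OF xy]]) simp
    show "word_metric G S x y \<le> max L L' * word_metric G T x y"
      unfolding word_metric_def by (rule order_trans[OF L(2)[OF xy]]) simp
  next
    fix w x y z assume "w \<in> carrier G" "x \<in> carrier G" "y \<in> carrier G" "z \<in> carrier G"
    from \<delta>[OF this] show "min (gromov_product (\<lambda>x y. real (word_metric G T x y)) w x y)
        (gromov_product (\<lambda>x y. real (word_metric G T x y)) w y z) - max 0 \<delta>
        \<le> gromov_product (\<lambda>x y. real (word_metric G T x y)) w x z"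
      unfolding word_dist_eq by linarith
  qed (use L(1) in auto)
  show ?thesis unfolding word_dist_eq by (rule coarsely_ultrametric_transfer)
qed

text \<open>The Cayley graph of any finite generating set of a hyperbolic group is a proper path metric space
  to which the results on coarse ultrametric Gromov products apply.\<close>
theorem gromov_boundary_monotone_quotient:
  fixes G :: "('g, 'm) monoid_scheme"
  assumes "hyperbolic_group G" "finite_generating_set G S"
  shows "\<exists>(\<Lambda> :: (real ^ 3) set) (q :: real ^ 3 \<Rightarrow> (nat \<Rightarrow> 'g) set).
    compact \<Lambda> \<and>
    quotient_map (top_of_set \<Lambda>) (gromov_boundary G S) q \<and>
    (\<forall>p\<in>topspace (gromov_boundary G S). connected {y \<in> \<Lambda>. q y = p})"
proof -
  have "group G" using assms(1) by (simp add: hyperbolic_group_def)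
  then interpret generated_group G S
    using assms(2) by (simp add: generated_group_def generated_group_axioms_def)
  interpret hyperbolic_at_infinity "carrier G" "word_metric G S" "\<one>\<^bsub>G\<^esub>"
  proof (intro hyperbolic_at_infinity.intro hyperbolic_at_infinity_axioms.intro)
    show "discrete_geodesic_space (carrier G) (word_metric G S)" by (rule word_metric_geodesic)
    have "word_metric G S \<one>\<^bsub>G\<^esub> x = word_norm G S x" if "x \<in> carrier G" for x
      using that by (simp add: word_metric_def)
    then show "finite {x \<in> carrier G. word_metric G S \<one>\<^bsub>G\<^esub> x \<le> n}" for n
      using finite_norm_balls[of n] by (simp cong: conj_cong)
    fix r
    show "\<exists>s. \<forall>x\<in>carrier G. \<forall>y\<in>carrier G. \<forall>z\<in>carrier G.
        s \<le> gromov_product (\<lambda>x y. real (word_metric G S x y)) \<one>\<^bsub>G\<^esub> x y \<and>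
        s \<le> gromov_product (\<lambda>x y. real (word_metric G S x y)) \<one>\<^bsub>G\<^esub> y z \<longrightarrow>
        r \<le> gromov_product (\<lambda>x y. real (word_metric G S x y)) \<one>\<^bsub>G\<^esub> x z"
      using hyperbolic_group_coarsely_ultrametric[OF assms, of r] one_closed unfolding word_dist_eq by blast
  qed simp
  show ?thesis
    unfolding gromov_boundary_def word_dist_eq by (rule boundary_monotone_quotient)
qed

theorem theorem4:
  fixes G :: "('g, 'm) monoid_scheme" and S :: "'g set"
    and K :: "'c cube_gluing" and x :: "('c \<times> (nat \<Rightarrow> real)) set"
  assumes "hyperbolic_group G"
    and "special_cube_complex K" and "compact_space (realization K)"
    and "x \<in> topspace (realization K)"
    and "G \<cong> fundamental_group (realization K) x"
    and "finite_generating_set G S"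
  shows "\<exists>(\<Lambda> :: (real ^ 3) set) (q :: real ^ 3 \<Rightarrow> (nat \<Rightarrow> 'g) set).
    compact \<Lambda> \<and>
    quotient_map (top_of_set \<Lambda>) (gromov_boundary G S) q \<and>
    (\<forall>p\<in>topspace (gromov_boundary G S). connected {y \<in> \<Lambda>. q y = p})"
  using assms(1,6) by (rule gromov_boundary_monotone_quotient)

end
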